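(* Let $p>1$ be odd and let $\epsilon\in\mathbb{C}$ be a primitive $p$th root of unity. For an integer $n$ write $n=n_0+pn_1$ with integers $n_0,n_1$ and $0\le n_0<p$. Let $s<0$ be an integer with $s_0\neq0$. Let $w_m=g(m+|s|,m)\in\mathcal{F}_\epsilon^2(2)$ for integers $m\ge0$, let $W^s=\mathrm{span}_{\mathbb{C}}\{w_m: m\ge0\}$ and $$W'=\mathrm{span}_{\mathbb{C}}\{w_m : m\ge 0,\ 0\le m_0<p-|s|_0\}.$$ Then the $U_\epsilon^{res}(sl_2)$-module $W'$ is isomorphic to $V_\epsilon^{res}(-(|s|+1))$, and the $U_\epsilon^{res}(sl_2)$-module $W^s/W'$ is isomorphic to $V_\epsilon^{res}(\lambda)$ with $\lambda=-(p-|s|_0+(1+|s|_1)p+1)$.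
   Context: Let $q$ be an indeterminate, $\mathcal{A}=\mathbb{C}[q,q^{-1}]$, $\mathbb{N}=\{1,2,\dots\}$, $\mathbb{Z}^+=\{0,1,2,\dots\}$. For $n\in\mathbb{Z}$, $m\in\mathbb{N}$: $[n]_q=\frac{q^n-q^{-n}}{q-q^{-1}}$, $[m]_q!=[m]_q\cdots[1]_q$, $\left[{n\atop m}\right]_q=\frac{[n]_q[n-1]_q\cdots[n-m+1]_q}{[m]_q!}$; also $\left[{n\atop 0}\right]_q=1$ and $\left[{n\atop m}\right]_q=0$ for $m<0$. These lie in $\mathcal{A}$, and $\left[{n\atop m}\right]_\epsilon$ denotes the value at $q=\epsilon$. $U_q(sl_2)$ is the associative $\mathbb{C}(q)$-algebra with generators $e,f,K^{\pm1}$ and relations $KK^{-1}=K^{-1}K=1$, $KeK^{-1}=q^2e$, $KfK^{-1}=q^{-2}f$, $[e,f]=\frac{K-K^{-1}}{q-q^{-1}}$. $U_{\mathcal{A}}^{res}(sl_2)$ is its $\mathcal{A}$-subalgebra generated by $K^{\pm1}$, $e^{(r)}=e^r/[r]_q!$, $f^{(r)}=f^r/[r]_q!$ ($r\in\mathbb{N}$). $U_\epsilon^{res}(sl_2)=U_{\mathcal{A}}^{res}(sl_2)\otimes_{\mathcal{A}}\mathbb{C}$ via $q\mapsto\epsilon$; elements $x\otimes1$ are written $x$. A $U_\epsilon^{res}(sl_2)$-module is of type 1 if $K$ is diagonalizable on it and $K^{\pm p}=1$. Let $\left[{K;0\atop p}\right]_q=\prod_{s=1}^p\frac{Kq^{1-s}-K^{-1}q^{s-1}}{q^s-q^{-s}}\in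 U_{\mathcal{A}}^{res}(sl_2)$. For $m\in\mathbb{Z}$, the weight space of weight $m$ of a type 1 module $V$ is $\{v\in V: Kv=\epsilon^m v,\ \left[{K;0\atop p}\right]_q v=\left[{m\atop p}\right]_\epsilon v\}$. A type 1 module is a highest weight module of highest weight $\lambda\in\mathbb{Z}$ if it is generated by a nonzero vector $v_\lambda$ of weight $\lambda$ with $ev_\lambda=e^{(p)}v_\lambda=0$. $V_\epsilon^{res}(\lambda)$ denotes the irreducible highest weight module of type 1 of highest weight $\lambda$ (unique up to isomorphism). The restricted q-Fock space $\mathcal{F}_\epsilon^2(2)$ is the complex vector space with basis $\{g(r_1,r_2): r_1,r_2\in\mathbb{Z}^+\}$ (specialization at $q=\epsilon$ of an $\mathcal{A}$-form of the q-Fock space of the rank-2 q-boson algebra, $g(r_1,r_2)=a_1^{+(r_1)}a_2^{+r_2}|0\rangle$). It is a type 1 $U_\epsilon^{res}(sl_2)$-module by (for $r\in\mathbb{N}$) $K^{\pm1}g(r_1,r_2)=\epsilon^{\mp(r_1+r_2+1)}g(r_1,r_2)$, $e^{(r)}g(r_1,r_2)=\left[{r_2\atop r_2-r}\right]_\epsilon g(r_1-r,r_2-r)$, $f^{(r)}g(r_1,r_2)=(-1)^r\left[{r+r_1\atop r}\right]_\epsilon g(r_1+r,r_2+r)$, where $g(\cdot,\cdot)$ with a negative index means $0$. The subspaces $W'\subset W^s$ are $U_\epsilon^{res}(sl_2)$-submodules of $\mathcal{F}_\epsilon^2(2)$. *)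

theory Defs
  imports
    Complex_Main
    "HOL-Computational_Algebra.Polynomial"
    "HOL-Computational_Algebra.Fraction_Field"
    "HOL-Library.Poly_Mapping"
    "HOL-Algebra.Module"
    "HOL-Algebra.QuotRing"
begin

section \<open>The field of rational functions in \<open>q\<close>, and Gaussian binomials\<close>

type_synonym ratfun = "complex poly fract"

definition qvar :: ratfun where
  "qvar = Fract [:0, 1:] 1"

definition ratconst :: "complex \<Rightarrow> ratfun" where
  "ratconst c = Fract [:c:] 1"

text \<open>The subring \<open>\<A> = \<complex>[q, q\<inverse>]\<close>, and the value of one of its elements at \<open>q = \<epsilon>\<close>
  (well defined for \<open>\<epsilon> \<noteq> 0\<close>).\<close>

definition laurent :: "ratfun set" where
  "laurent = {Fract P 1 / qvar ^ n | P n. True}"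

definition value_at :: "complex \<Rightarrow> ratfun \<Rightarrow> complex" where
  "value_at \<epsilon> x = (THE c. \<exists>P n. x = Fract P 1 / qvar ^ n \<and> c = poly P \<epsilon> / \<epsilon> ^ n)"

definition qint :: "int \<Rightarrow> ratfun" where
  "qint n = (qvar powi n - qvar powi (- n)) / (qvar - qvar powi (- 1))"

definition qfact :: "nat \<Rightarrow> ratfun" where
  "qfact m = (\<Prod>k = 1..m. qint (int k))"

definition qbinom :: "int \<Rightarrow> int \<Rightarrow> ratfun" where
  "qbinom n m =
    (if m < 0 then 0 else (\<Prod>i < nat m. qint (n - int i)) / qfact (nat m))"

abbreviation qbinom_at :: "complex \<Rightarrow> int \<Rightarrow> int \<Rightarrow> complex" where
  "qbinom_at \<epsilon> n m \<equiv> value_at \<epsilon> (qbinom n m)"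


section \<open>The algebra \<open>U\<^sub>q(sl\<^sub>2)\<close>\<close>

text \<open>The presented algebra is the set of formal expressions in the generators and the scalars,
  modulo the least congruence containing the axioms of unital associative algebras over the
  field of rational functions and the defining relations.\<close>

datatype gen = GE | GF | GK | GKinv

datatype expr = Gen gen | Scal ratfun | Plus expr expr | Times expr expr

inductive uq_eq :: "expr \<Rightarrow> expr \<Rightarrow> bool" (infix \<open>\<doteq>\<close> 50) where
  refl: "x \<doteq> x"
| sym: "x \<doteq> y \<Longrightarrow> y \<doteq> x"
| trans: "x \<doteq> y \<Longrightarrow> y \<doteq> z \<Longrightarrow> x \<doteq> z"
| plus_cong: "x \<doteq> x' \<Longrightarrow> y \<doteq> y' \<Longrightarrow> Plus x y \<doteq> Plus x' y'"
| times_cong: "x \<doteq> x' \<Longrightarrow> y \<doteq> y' \<Longrightarrow> Times x y \<doteq> Times x' y'"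
| plus_assoc: "Plus (Plus x y) z \<doteq> Plus x (Plus y z)"
| plus_comm: "Plus x y \<doteq> Plus y x"
| plus_zero: "Plus (Scal 0) x \<doteq> x"
| plus_neg: "Plus (Times (Scal (- 1)) x) x \<doteq> Scal 0"
| times_assoc: "Times (Times x y) z \<doteq> Times x (Times y z)"
| times_one: "Times (Scal 1) x \<doteq> x"
| distrib_right: "Times (Plus x y) z \<doteq> Plus (Times x z) (Times y z)"
| distrib_left: "Times x (Plus y z) \<doteq> Plus (Times x y) (Times x z)"
| scal_plus: "Scal (a + b) \<doteq> Plus (Scal a) (Scal b)"
| scal_times: "Scal (a * b) \<doteq> Times (Scal a) (Scal b)"
| scal_central: "Times (Scal a) x \<doteq> Times x (Scal a)"
| K_Kinv: "Times (Gen GK) (Gen GKinv) \<doteq> Scal 1"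
| Kinv_K: "Times (Gen GKinv) (Gen GK) \<doteq> Scal 1"
| K_e: "Times (Times (Gen GK) (Gen GE)) (Gen GKinv) \<doteq> Times (Scal (qvar ^ 2)) (Gen GE)"
| K_f: "Times (Times (Gen GK) (Gen GF)) (Gen GKinv) \<doteq> Times (Scal (qvar powi (- 2))) (Gen GF)"
| e_f: "Plus (Times (Gen GE) (Gen GF)) (Times (Scal (- 1)) (Times (Gen GF) (Gen GE))) \<doteq>
        Times (Scal (1 / (qvar - qvar powi (- 1))))
          (Plus (Gen GK) (Times (Scal (- 1)) (Gen GKinv)))"

text \<open>The trivial representation; it is used only to see that \<open>0 \<noteq> 1\<close> in \<open>U\<^sub>q(sl\<^sub>2)\<close>.\<close>

primrec counit :: "expr \<Rightarrow> ratfun" where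
  "counit (Gen g) = (if g = GK \<or> g = GKinv then 1 else 0)"
| "counit (Scal a) = a"
| "counit (Plus x y) = counit x + counit y"
| "counit (Times x y) = counit x * counit y"

lemma counit_cong: "x \<doteq> y \<Longrightarrow> counit x = counit y"
  by (induction rule: uq_eq.induct) (simp_all add: algebra_simps)

quotient_type uq = expr / uq_eq
  by (rule equivpI) (auto intro!: reflpI sympI transpI intro: uq_eq.intros)

instantiation uq :: ring_1
begin

lift_definition zero_uq :: uq is "Scal 0" .
lift_definition one_uq :: uq is "Scal 1" .
lift_definition plus_uq :: "uq \<Rightarrow> uq \<Rightarrow> uq" is Plus by (rule plus_cong)
lift_definition times_uq :: "uq \<Rightarrow> uq \<Rightarrow> uq" is Times by (rule times_cong)
lift_definition uminus_uq :: "uq \<Rightarrow> uq" is "Times (Scal (- 1))"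
  by (rule times_cong[OF uq_eq.refl])

definition minus_uq :: "uq \<Rightarrow> uq \<Rightarrow> uq" where
  "minus_uq x y = x + - y"

instance
proof
  fix a b c :: uq
  show "a + b + c = a + (b + c)" by transfer (rule plus_assoc)
  show "a + b = b + a" by transfer (rule plus_comm)
  show "0 + a = a" by transfer (rule plus_zero)
  show "- a + a = 0" by transfer (rule plus_neg)
  show "a - b = a + - b" by (rule minus_uq_def)
  show "a * b * c = a * (b * c)" by transfer (rule times_assoc)
  show "1 * a = a" by transfer (rule times_one)
  show "a * 1 = a" by transfer (blast intro: uq_eq.intros)
  show "(a + b) * c = a * c + b * c" by transfer (rule uq_eq.distrib_right)
  show "a * (b + c) = a * b + a * c" by transfer (rule uq_eq.distrib_left)
  show "(0 :: uq) \<noteq> 1" by transfer (auto dest: counit_cong)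
qed

end

lift_definition uq_e :: uq is "Gen GE" .
lift_definition uq_f :: uq is "Gen GF" .
lift_definition uq_K :: uq is "Gen GK" .
lift_definition uq_Kinv :: uq is "Gen GKinv" .
lift_definition uq_scal :: "ratfun \<Rightarrow> uq" is Scal .

definition uq_e_dp :: "nat \<Rightarrow> uq" where
  "uq_e_dp r = uq_scal (1 / qfact r) * uq_e ^ r"

definition uq_f_dp :: "nat \<Rightarrow> uq" where
  "uq_f_dp r = uq_scal (1 / qfact r) * uq_f ^ r"

text \<open>The factors of the following product commute with each other.\<close>

definition uq_Kbin :: "nat \<Rightarrow> uq" where
  "uq_Kbin p = (\<Prod>s \<leftarrow> map int [1..<Suc p].
     uq_scal (1 / (qvar powi s - qvar powi (- s))) *
     (uq_scal (qvar powi (1 - s)) * uq_K - uq_scal (qvar powi (s - 1)) * uq_Kinv))"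


section \<open>The restricted integral form and its specialization\<close>

inductive_set Ures_int :: "uq set" where
  scal: "a \<in> laurent \<Longrightarrow> uq_scal a \<in> Ures_int"
| K: "uq_K \<in> Ures_int"
| Kinv: "uq_Kinv \<in> Ures_int"
| e_dp: "r \<ge> 1 \<Longrightarrow> uq_e_dp r \<in> Ures_int"
| f_dp: "r \<ge> 1 \<Longrightarrow> uq_f_dp r \<in> Ures_int"
| plus: "x \<in> Ures_int \<Longrightarrow> y \<in> Ures_int \<Longrightarrow> x + y \<in> Ures_int"
| times: "x \<in> Ures_int \<Longrightarrow> y \<in> Ures_int \<Longrightarrow> x * y \<in> Ures_int"

definition UresA :: "uq ring" where
  "UresA = \<lparr>carrier = Ures_int, mult = (*), one = 1, zero = 0, add = (+)\<rparr>"

text \<open>Via \<open>q \<mapsto> \<epsilon>\<close> the \<open>\<A>\<close>-module \<open>\<complex>\<close> is \<open>\<A>/(q - \<epsilon>)\<A>\<close>, so that the base change of the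
  \<open>\<A>\<close>-algebra \<open>UresA\<close> to \<open>\<complex>\<close> is its quotient by the ideal generated by the central
  element \<open>q - \<epsilon>\<close>.\<close>

definition spec_ideal :: "complex \<Rightarrow> uq set" where
  "spec_ideal \<epsilon> = {uq_scal (qvar - ratconst \<epsilon>) * u | u. u \<in> Ures_int}"

definition Ures :: "complex \<Rightarrow> uq set ring" where
  "Ures \<epsilon> = UresA Quot spec_ideal \<epsilon>"

text \<open>\<open>spec \<epsilon> x\<close> is \<open>x \<otimes> 1\<close>, for \<open>x\<close> in \<open>Ures_int\<close>.\<close>

definition spec :: "complex \<Rightarrow> uq \<Rightarrow> uq set" where
  "spec \<epsilon> x = spec_ideal \<epsilon> +>\<^bsub>UresA\<^esub> x"

definition spec_scal :: "complex \<Rightarrow> complex \<Rightarrow> uq set" where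
  "spec_scal \<epsilon> c = spec \<epsilon> (uq_scal (ratconst c))"


section \<open>Modules over a not necessarily commutative ring\<close>

text \<open>The locale \<^locale>\<open>Module.module\<close> requires a commutative base ring.\<close>

locale left_module = R?: ring R + M?: abelian_group M
  for R (structure) and M (structure) +
  assumes smult_closed:
      "\<lbrakk>a \<in> carrier R; x \<in> carrier M\<rbrakk> \<Longrightarrow> a \<odot>\<^bsub>M\<^esub> x \<in> carrier M"
    and smult_l_distr:
      "\<lbrakk>a \<in> carrier R; b \<in> carrier R; x \<in> carrier M\<rbrakk> \<Longrightarrow>
        (a \<oplus> b) \<odot>\<^bsub>M\<^esub> x = a \<odot>\<^bsub>M\<^esub> x \<oplus>\<^bsub>M\<^esub> b \<odot>\<^bsub>M\<^esub> x"
    and smult_r_distr: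
      "\<lbrakk>a \<in> carrier R; x \<in> carrier M; y \<in> carrier M\<rbrakk> \<Longrightarrow>
        a \<odot>\<^bsub>M\<^esub> (x \<oplus>\<^bsub>M\<^esub> y) = a \<odot>\<^bsub>M\<^esub> x \<oplus>\<^bsub>M\<^esub> a \<odot>\<^bsub>M\<^esub> y"
    and smult_assoc:
      "\<lbrakk>a \<in> carrier R; b \<in> carrier R; x \<in> carrier M\<rbrakk> \<Longrightarrow>
        (a \<otimes> b) \<odot>\<^bsub>M\<^esub> x = a \<odot>\<^bsub>M\<^esub> (b \<odot>\<^bsub>M\<^esub> x)"
    and smult_one:
      "x \<in> carrier M \<Longrightarrow> \<one> \<odot>\<^bsub>M\<^esub> x = x"

definition restrict_module :: "('r, 'm) module \<Rightarrow> 'm set \<Rightarrow> ('r, 'm) module" where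
  "restrict_module M N = M\<lparr>carrier := N\<rparr>"

definition quotient_module :: "('r, 'm) module \<Rightarrow> 'm set \<Rightarrow> ('r, 'm set) module" where
  "quotient_module M N =
    \<lparr>carrier = a_rcosets\<^bsub>M\<^esub> N, mult = undefined, one = undefined, zero = N, add = set_add M,
     smult = (\<lambda>a X. \<Union>x\<in>X. N +>\<^bsub>M\<^esub> (a \<odot>\<^bsub>M\<^esub> x))\<rparr>"

definition module_iso ::
    "('r, 'x) ring_scheme \<Rightarrow> ('r, 'm) module \<Rightarrow> ('r, 'n) module \<Rightarrow> bool" where
  "module_iso R M N \<longleftrightarrow> left_module R M \<and> left_module R N \<and>
    (\<exists>h. bij_betw h (carrier M) (carrier N) \<and>
      (\<forall>x\<in>carrier M. \<forall>y\<in>carrier M. h (x \<oplus>\<^bsub>M\<^esub> y) = h x \<oplus>\<^bsub>N\<^esub> h y) \<and>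
      (\<forall>a\<in>carrier R. \<forall>x\<in>carrier M. h (a \<odot>\<^bsub>M\<^esub> x) = a \<odot>\<^bsub>N\<^esub> h x))"

definition irreducible_module :: "('r, 'x) ring_scheme \<Rightarrow> ('r, 'm) module \<Rightarrow> bool" where
  "irreducible_module R M \<longleftrightarrow> left_module R M \<and> carrier M \<noteq> {\<zero>\<^bsub>M\<^esub>} \<and>
    (\<forall>N. submodule N R M \<longrightarrow> N = {\<zero>\<^bsub>M\<^esub>} \<or> N = carrier M)"

definition generated_by :: "('r, 'x) ring_scheme \<Rightarrow> ('r, 'm) module \<Rightarrow> 'm \<Rightarrow> bool" where
  "generated_by R M v \<longleftrightarrow> v \<in> carrier M \<and>
    (\<forall>N. submodule N R M \<and> v \<in> N \<longrightarrow> N = carrier M)"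


section \<open>Highest weight modules of type 1\<close>

text \<open>The complex vector space structure of a module over \<open>Ures \<epsilon>\<close> is the one given by the
  scalars \<open>spec_scal \<epsilon> c\<close>.\<close>

definition K_eigenvector :: "complex \<Rightarrow> (uq set, 'm) module \<Rightarrow> 'm \<Rightarrow> bool" where
  "K_eigenvector \<epsilon> M v \<longleftrightarrow> v \<in> carrier M \<and> v \<noteq> \<zero>\<^bsub>M\<^esub> \<and>
    (\<exists>c. spec \<epsilon> uq_K \<odot>\<^bsub>M\<^esub> v = spec_scal \<epsilon> c \<odot>\<^bsub>M\<^esub> v)"

text \<open>Diagonalizability (in possibly infinite dimension): the module is spanned by eigenvectors.
  Multiples of eigenvectors being eigenvectors, no coefficients are needed.\<close>

definition K_diagonalizable :: "complex \<Rightarrow> (uq set, 'm) module \<Rightarrow> bool" where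
  "K_diagonalizable \<epsilon> M \<longleftrightarrow> (\<forall>v\<in>carrier M. \<exists>S.
    finite S \<and> (\<forall>x\<in>S. K_eigenvector \<epsilon> M x) \<and> v = finsum M (\<lambda>x. x) S)"

definition type_1 :: "complex \<Rightarrow> nat \<Rightarrow> (uq set, 'm) module \<Rightarrow> bool" where
  "type_1 \<epsilon> p M \<longleftrightarrow> left_module (Ures \<epsilon>) M \<and> K_diagonalizable \<epsilon> M \<and>
    (\<forall>v\<in>carrier M. spec \<epsilon> (uq_K ^ p) \<odot>\<^bsub>M\<^esub> v = v \<and> spec \<epsilon> (uq_Kinv ^ p) \<odot>\<^bsub>M\<^esub> v = v)"

definition weight_space :: "complex \<Rightarrow> nat \<Rightarrow> (uq set, 'm) module \<Rightarrow> int \<Rightarrow> 'm set" where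
  "weight_space \<epsilon> p M m = {v \<in> carrier M.
    spec \<epsilon> uq_K \<odot>\<^bsub>M\<^esub> v = spec_scal \<epsilon> (\<epsilon> powi m) \<odot>\<^bsub>M\<^esub> v \<and>
    spec \<epsilon> (uq_Kbin p) \<odot>\<^bsub>M\<^esub> v = spec_scal \<epsilon> (qbinom_at \<epsilon> m (int p)) \<odot>\<^bsub>M\<^esub> v}"

definition highest_weight_module ::
    "complex \<Rightarrow> nat \<Rightarrow> (uq set, 'm) module \<Rightarrow> int \<Rightarrow> bool" where
  "highest_weight_module \<epsilon> p M lam \<longleftrightarrow> type_1 \<epsilon> p M \<and>
    (\<exists>v \<in> weight_space \<epsilon> p M lam. v \<noteq> \<zero>\<^bsub>M\<^esub> \<and>
      spec \<epsilon> uq_e \<odot>\<^bsub>M\<^esub> v = \<zero>\<^bsub>M\<^esub> \<and> spec \<epsilon> (uq_e_dp p) \<odot>\<^bsub>M\<^esub> v = \<zero>\<^bsub>M\<^esub> \<and>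
      generated_by (Ures \<epsilon>) M v)"

text \<open>\<open>is_Vres \<epsilon> p V \<lambda>\<close>: the module \<open>V\<close> is a model of the irreducible module of type 1 with
  highest weight \<open>\<lambda>\<close>, which is determined up to isomorphism only.\<close>

definition is_Vres :: "complex \<Rightarrow> nat \<Rightarrow> (uq set, 'm) module \<Rightarrow> int \<Rightarrow> bool" where
  "is_Vres \<epsilon> p V lam \<longleftrightarrow>
    irreducible_module (Ures \<epsilon>) V \<and> highest_weight_module \<epsilon> p V lam"


section \<open>The restricted q-Fock space\<close>

type_synonym fock_space = "(nat \<times> nat) \<Rightarrow>\<^sub>0 complex"

definition fock_scale :: "complex \<Rightarrow> fock_space \<Rightarrow> fock_space" where
  "fock_scale c v = Poly_Mapping.map ((*) c) v"

lemma lookup_fock_scale: "Poly_Mapping.lookup (fock_scale c v) k = c * Poly_Mapping.lookup v k"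
  by (simp add: fock_scale_def Poly_Mapping.map.rep_eq when_def)

global_interpretation fock: vector_space fock_scale
  defines fock_span = fock.span
  by unfold_locales
    (auto simp: poly_mapping_eq_iff fun_eq_iff lookup_fock_scale lookup_add algebra_simps)

text \<open>The basis vectors, with \<open>fock_g r\<^sub>1 r\<^sub>2 = 0\<close> if an index is negative.\<close>

definition fock_g :: "int \<Rightarrow> int \<Rightarrow> fock_space" where
  "fock_g r1 r2 = (if r1 < 0 \<or> r2 < 0 then 0 else Poly_Mapping.single (nat r1, nat r2) 1)"

definition fock_module_of :: "(uq set \<Rightarrow> fock_space \<Rightarrow> fock_space) \<Rightarrow> (uq set, fock_space) module"
  where "fock_module_of act =
    \<lparr>carrier = UNIV, mult = undefined, one = undefined, zero = 0, add = (+), smult = act\<rparr>"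

definition is_fock_action :: "complex \<Rightarrow> (uq set \<Rightarrow> fock_space \<Rightarrow> fock_space) \<Rightarrow> bool" where
  "is_fock_action \<epsilon> act \<longleftrightarrow>
    left_module (Ures \<epsilon>) (fock_module_of act) \<and>
    (\<forall>c v. act (spec_scal \<epsilon> c) v = fock_scale c v) \<and>
    (\<forall>r1 \<ge> 0. \<forall>r2 \<ge> 0.
      act (spec \<epsilon> uq_K) (fock_g r1 r2) = fock_scale (\<epsilon> powi (- (r1 + r2 + 1))) (fock_g r1 r2) \<and>
      act (spec \<epsilon> uq_Kinv) (fock_g r1 r2) = fock_scale (\<epsilon> powi (r1 + r2 + 1)) (fock_g r1 r2) \<and>
      (\<forall>r \<ge> 1.
        act (spec \<epsilon> (uq_e_dp r)) (fock_g r1 r2) =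
          fock_scale (qbinom_at \<epsilon> r2 (r2 - int r)) (fock_g (r1 - int r) (r2 - int r)) \<and>
        act (spec \<epsilon> (uq_f_dp r)) (fock_g r1 r2) =
          fock_scale ((- 1) ^ r * qbinom_at \<epsilon> (int r + r1) (int r)) (fock_g (r1 + int r) (r2 + int r))))"

text \<open>The formulas above determine the action on the carrier of \<open>Ures \<epsilon>\<close>, which is generated by
  these elements; the choice concerns only the irrelevant values outside of that carrier.\<close>

definition fock_module :: "complex \<Rightarrow> (uq set, fock_space) module" where
  "fock_module \<epsilon> = fock_module_of (SOME act. is_fock_action \<epsilon> act)"

definition fock_w :: "int \<Rightarrow> int \<Rightarrow> fock_space" where
  "fock_w s m = fock_g (m + \<bar>s\<bar>) m"

definition Ws :: "int \<Rightarrow> fock_space set" where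
  "Ws s = fock_span {fock_w s m | m. m \<ge> 0}"

definition Wprime :: "nat \<Rightarrow> int \<Rightarrow> fock_space set" where
  "Wprime p s = fock_span {fock_w s m | m. m \<ge> 0 \<and> m mod int p < int p - \<bar>s\<bar> mod int p}"

end

theory Submission
  imports Defs
begin

text \<open>
  Put \<open>a = \<bar>s\<bar>\<close>. The vectors \<open>w\<^sub>m = g(m + a, m)\<close> form a single line, along which \<open>e\<^sup>(\<^sup>r\<^sup>)\<close> steps
  down by \<open>r\<close> with the coefficient \<open>[m over r]\<close> and \<open>f\<^sup>(\<^sup>r\<^sup>)\<close> steps up by \<open>r\<close> with the
  coefficient \<open>[m + r + a over r]\<close> up to sign, while \<open>K\<close> is diagonal. So the module structure is a matter of which
  Gaussian binomials vanish at \<open>\<epsilon>\<close>. The quantum Lucas theorem (\<open>gbin_lucas\<close>) says that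
  \<open>[n over r]\<close> with \<open>r \<le> n\<close> vanishes at \<open>\<epsilon>\<close> exactly when \<open>r\<^sub>0 > n\<^sub>0\<close>, that is, when the addition of
  \<open>r\<close> and \<open>n - r\<close> produces a carry out of the lowest digit in base \<open>p\<close>. Every step from an index with
  \<open>m\<^sub>0 < p - a\<^sub>0\<close> to an index violating this inequality involves such a carry, whence \<open>W'\<close> is a submodule.

  The irreducibility of \<open>W'\<close> and of \<open>W\<^sup>s/W'\<close> has one proof, given in the locale \<open>line_subquotient\<close>.
  Let \<open>h\<close> be the lowest index that occurs: \<open>0\<close> for \<open>W'\<close>, and \<open>p - a\<^sub>0\<close> for the quotient. If \<open>M\<close> is the top
  index of a nonzero vector \<open>v\<close>, then \<open>e\<^sup>(\<^sup>M\<^sup>-\<^sup>h\<^sup>)\<close> sends \<open>v\<close> to a nonzero multiple of \<open>w\<^sub>h\<close>, since the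
  indices below \<open>M\<close> would end up below \<open>h\<close>; and \<open>f\<^sup>(\<^sup>m\<^sup>-\<^sup>h\<^sup>)\<close> sends \<open>w\<^sub>h\<close> to a nonzero multiple of \<open>w\<^sub>m\<close>.
  Both coefficients are nonzero by Lucas. The vector
  \<open>w\<^sub>h\<close> is the highest weight vector, of weight \<open>-(2h + a + 1)\<close>, and the two values of \<open>h\<close> give the two
  weights in the theorem.

  Two things underlie this. First, the action on the Fock space has to be constructed, because at \<open>\<epsilon>\<close>
  the divided powers do not follow from \<open>e\<close> and \<open>f\<close>. The relations are checked over the rational
  functions in \<open>q\<close> (\<open>rep\<close>); the integral form preserves \<open>\<A>\<close>-valued coordinates, and evaluation at \<open>\<epsilon>\<close>
  gives the action (\<open>fock_rep_action\<close>), which the formulas on generators determine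
  (\<open>fock_action_unique\<close>). Secondly, the weight refers to \<open>[K; 0 over p]\<close>, which must be shown to lie in the
  integral form. This follows from the commutation formula for \<open>e\<^sup>(\<^sup>r\<^sup>)\<close> and \<open>f\<^sup>(\<^sup>s\<^sup>)\<close> (\<open>uq_e_dp_f_dp\<close>), in which
  \<open>[K; 0 over r]\<close> is one of the summands for \<open>r = s\<close>.
\<close>

section \<open>Gaussian binomials over an arbitrary field\<close>

text \<open>The Gaussian integer \<open>[k]\<close> without its denominator \<open>q - q\<inverse>\<close>. In a Gaussian binomial these
  denominators cancel, and the product formulas below hold also where \<open>q\<^sup>2 = 1\<close>.\<close>

definition qdiff :: "'a::field \<Rightarrow> int \<Rightarrow> 'a" where
  "qdiff q k = q powi k - q powi (- k)"

text \<open>Gaussian binomials by the Pascal recursion: unlike a quotient of factorials, it makes sense at a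
  root of unity, and it visibly commutes with the evaluation of Laurent polynomials.\<close>

fun gbin :: "'a::field \<Rightarrow> nat \<Rightarrow> nat \<Rightarrow> 'a" where
  "gbin q n 0 = 1"
| "gbin q 0 (Suc r) = 0"
| "gbin q (Suc n) (Suc r) =
     q powi (- int (Suc r)) * gbin q n (Suc r) + q powi (int n - int r) * gbin q n r"

lemma gbin_eq_0: "n < r \<Longrightarrow> gbin q n r = 0"
  by (induction q n r rule: gbin.induct) auto

lemma gbin_self [simp]: "gbin q n n = 1"
  by (induction n) (auto simp: gbin_eq_0)

lemma qdiff_0 [simp]: "qdiff q 0 = 0"
  by (simp add: qdiff_def)

lemma qdiff_eq_0_iff:
  assumes "q \<noteq> 0"
  shows "qdiff q k = 0 \<longleftrightarrow> q powi (2 * k) = 1"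
proof -
  have "qdiff q k * q powi k = q powi (2 * k) - 1"
    using assms by (simp add: qdiff_def algebra_simps flip: power_int_add)
  moreover have "q powi k \<noteq> 0"
    using assms by simp
  ultimately show ?thesis
    by (metis (no_types, lifting) diff_eq_diff_eq diff_self mult_eq_0_iff right_minus_eq)
qed

lemma qdiff_add:
  assumes "q \<noteq> 0"
  shows "q powi (- y) * qdiff q x + q powi x * qdiff q y = qdiff q (x + y)"
  using assms by (simp add: qdiff_def algebra_simps flip: power_int_add)

text \<open>The induction step multiplies the Pascal recursion by the denominators and
  is then the addition law \<open>qdiff_add\<close>.\<close>

lemma gbin_mult_prod:
  assumes q: "q \<noteq> 0"
  shows "gbin q n r * (\<Prod>k=1..r. qdiff q (int k)) = (\<Prod>i<r. qdiff q (int n - int i))"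
proof (induction n arbitrary: r)
  case 0
  show ?case by (cases r) (auto simp: prod.lessThan_Suc_shift simp del: prod.lessThan_Suc)
next
  case (Suc n)
  show ?case
  proof (cases r)
    case (Suc m)
    let ?P = "\<Prod>i<m. qdiff q (int n - int i)"
    have IH: "gbin q n m * (\<Prod>k=1..m. qdiff q (int k)) = ?P"
      "gbin q n (Suc m) * (\<Prod>k=1..Suc m. qdiff q (int k)) = ?P * qdiff q (int n - int m)"
      using Suc.IH[of m] Suc.IH[of "Suc m"] by simp_all
    have "gbin q (Suc n) r * (\<Prod>k=1..r. qdiff q (int k)) =
        q powi (- int (Suc m)) * (gbin q n (Suc m) * (\<Prod>k=1..Suc m. qdiff q (int k)))
      + q powi (int n - int m) * (gbin q n m * (\<Prod>k=1..m. qdiff q (int k))) * qdiff q (int (Suc m))"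
      unfolding Suc by (simp add: algebra_simps)
    also have "\<dots> = ?P * (q powi (- int (Suc m)) * qdiff q (int n - int m)
        + q powi (int n - int m) * qdiff q (int (Suc m)))"
      unfolding IH by (simp add: algebra_simps)
    also have "\<dots> = ?P * qdiff q (int (Suc n))"
      unfolding qdiff_add[OF q] by (simp add: algebra_simps)
    also have "\<dots> = (\<Prod>i<r. qdiff q (int (Suc n) - int i))"
      unfolding Suc prod.lessThan_Suc_shift by (simp add: algebra_simps)
    finally show ?thesis .
  qed auto
qed

lemma prod_qdiff_falling:
  "r \<le> n \<Longrightarrow> (\<Prod>i<r. qdiff q (int n - int i)) * (\<Prod>k=1..n - r. qdiff q (int k)) =
    (\<Prod>k=1..n. qdiff q (int k))"
proof (induction r)
  case (Suc r)
  have "n - r = Suc (n - Suc r)" "int n - int r = int (n - r)"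
    using Suc.prems by auto
  then have "(\<Prod>k=1..n - r. qdiff q (int k)) =
      (\<Prod>k=1..n - Suc r. qdiff q (int k)) * qdiff q (int n - int r)"
    by (metis prod.nat_ivl_Suc' One_nat_def Suc_le_mono le0 mult.commute)
  then show ?case
    using Suc by (simp add: algebra_simps)
qed simp

text \<open>With \<open>D r\<close> the product of the \<open>qdiff q k\<close> for \<open>1 \<le> k \<le> r\<close>, the product formula becomes
  \<open>gbin q n r * D r * D (n - r) = D n\<close>, which is symmetric in \<open>r\<close> and \<open>n - r\<close>.\<close>

lemma gbin_symmetric:
  assumes q: "q \<noteq> 0" and nz: "\<And>k. 0 < k \<Longrightarrow> k \<le> int n \<Longrightarrow> qdiff q k \<noteq> 0" and "r \<le> n"
  shows "gbin q n (n - r) = gbin q n r"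
proof -
  let ?D = "\<lambda>r. \<Prod>k=1..r. qdiff q (int k)"
  have D: "?D r \<noteq> 0" if "r \<le> n" for r
    using nz that by auto
  have "gbin q n r * ?D r * ?D (n - r) = ?D n" if "r \<le> n" for r
    using gbin_mult_prod[OF q, of n r] prod_qdiff_falling[OF that, of q] by simp
  from this[of r] this[of "n - r"] have "gbin q n (n - r) * (?D r * ?D (n - r)) = gbin q n r * (?D r * ?D (n - r))"
    using \<open>r \<le> n\<close> by (simp add: mult_ac)
  then show ?thesis
    using D[of r] D[of "n - r"] \<open>r \<le> n\<close> by simp
qed


section \<open>Gaussian binomials at a root of unity\<close>

context
  fixes q :: complex and p :: nat
  assumes p: "p > 1" "odd p"
    and root: "q ^ p = 1" and primitive: "\<forall>k. 0 < k \<and> k < p \<longrightarrow> q ^ k \<noteq> 1"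
begin

lemma root_nonzero: "q \<noteq> 0"
  using root p by (metis less_nat_zero_code power_0_left zero_neq_one)

lemma root_power_eq_1_iff: "q ^ n = 1 \<longleftrightarrow> p dvd n"
proof -
  have "q ^ n = q ^ (p * (n div p) + n mod p)"
    by simp
  also have "\<dots> = q ^ (n mod p)"
    unfolding power_add power_mult root by simp
  finally show ?thesis
    using primitive p by (metis bot_nat_0.not_eq_extremum dvd_eq_mod_eq_0 mod_less_divisor power_0 zero_less_one order_less_trans)
qed

lemma root_powi_cong:
  assumes "int p dvd x - y"
  shows "q powi x = q powi y"
proof -
  obtain z where "x = y + int p * z"
    using assms by (metis add.commute diff_add_cancel dvdE)
  moreover have "q powi (int p * z) = 1"
    by (simp add: power_int_mult root)
  ultimately show ?thesis
    using root_nonzero by (simp add: power_int_add)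
qed

text \<open>Here the oddness of \<open>p\<close> enters: \<open>q\<close> to the power \<open>2k\<close> is \<open>1\<close> only if \<open>p\<close> divides \<open>k\<close>.\<close>

lemma qdiff_root_nonzero:
  assumes "0 < k" "k < p"
  shows "qdiff q (int k) \<noteq> 0"
proof
  assume "qdiff q (int k) = 0"
  then have "q powi (int (2 * k)) = 1"
    by (simp add: qdiff_eq_0_iff[OF root_nonzero])
  then have "p dvd 2 * k"
    unfolding power_int_of_nat root_power_eq_1_iff .
  then have "p dvd k"
    using p by (simp add: coprime_dvd_mult_right_iff)
  with assms show False
    by (simp add: nat_dvd_not_less)
qed

lemma prod_qdiff_root_nonzero: "r < p \<Longrightarrow> (\<Prod>k=1..r. qdiff q (int k)) \<noteq> 0"
  using qdiff_root_nonzero by auto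

lemma gbin_root_nonzero:
  assumes "r \<le> n" "n < p"
  shows "gbin q n r \<noteq> 0"
proof -
  have "gbin q n r * (\<Prod>k=1..r. qdiff q (int k)) \<noteq> 0"
    unfolding gbin_mult_prod[OF root_nonzero]
  proof (clarsimp simp: prod_zero_iff)
    fix i assume i: "i < r" "qdiff q (int n - int i) = 0"
    then have "int n - int i = int (n - i)" "0 < n - i" "n - i < p"
      using assms by auto
    with i show False
      by (metis qdiff_root_nonzero)
  qed
  then show ?thesis by auto
qed

lemma gbin_root_p:
  assumes "0 < r" "r < p"
  shows "gbin q p r = 0"
proof -
  have "qdiff q (int p) = 0"
    by (simp add: qdiff_eq_0_iff[OF root_nonzero] power_int_mult root mult.commute[of 2])
  then have "(\<Prod>i<r. qdiff q (int p - int i)) = 0"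
    using assms by (intro prod_zero) (auto intro: bexI[of _ 0])
  then show ?thesis
    using gbin_mult_prod[OF root_nonzero, of p r] prod_qdiff_root_nonzero[OF assms(2)]
    by (metis mult_eq_0_iff)
qed

text \<open>The quantum Lucas theorem. The right hand side satisfies the same recursion as the left: the powers
  of \<open>q\<close> in it depend on residues only. Inside a block of length \<open>p\<close> this is the recursion of the small Gaussian
  binomial. Across the end of a block it is the Pascal triangle of ordinary binomials if
  \<open>r\<close> also completes a block, and the vanishing of \<open>gbin q p r\<close> for \<open>0 < r < p\<close> otherwise.\<close>

theorem gbin_lucas:
  "gbin q n r = gbin q (n mod p) (r mod p) * of_nat ((n div p) choose (r div p))"
proof (induction n arbitrary: r)
  case 0
  show ?case
  proof (cases "r = 0")
    case False
    then have "0 < r mod p \<or> 0 < r div p"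
      using div_mult_mod_eq[of r p] by (metis add_0 gr0I mult_0)
    then show ?thesis
      using False by (auto simp: gbin_eq_0)
  qed simp
next
  case (Suc n)
  show ?case
  proof (cases r)
    case 0
    then show ?thesis by simp
  next
    case r: (Suc m)
    let ?n0 = "n mod p" and ?m0 = "m mod p" and ?n1 = "n div p" and ?m1 = "m div p"
    have coeffs: "q powi (- int (Suc m)) = q powi (- int (Suc ?m0))"
      "q powi (int n - int m) = q powi (int ?n0 - int ?m0)"
      by (rule root_powi_cong; simp add: zmod_int mod_eq_dvd_iff[symmetric] mod_simps)+
    have lt: "?n0 < p" "?m0 < p" using p by auto
    have step: "gbin q (Suc n) r = q powi (- int (Suc ?m0)) * gbin q n (Suc m)
       + q powi (int ?n0 - int ?m0) * (gbin q ?n0 ?m0 * of_nat (?n1 choose ?m1))"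
      unfolding r gbin.simps coeffs Suc.IH[of m] ..
    show ?thesis
    proof (cases "Suc ?m0 = p")
      case False
      then have m: "Suc m mod p = Suc ?m0" "Suc m div p = ?m1"
        by (simp_all add: mod_Suc div_Suc)
      have *: "gbin q (Suc n) r = gbin q (Suc ?n0) (Suc ?m0) * of_nat (?n1 choose ?m1)"
        unfolding step Suc.IH[of "Suc m"] m by (simp add: algebra_simps)
      show ?thesis
      proof (cases "Suc ?n0 = p")
        case True
        then have "Suc n mod p = 0" by (simp add: mod_Suc)
        moreover have "gbin q (Suc ?n0) (Suc ?m0) = 0"
          unfolding True using False lt by (intro gbin_root_p) auto
        ultimately show ?thesis
          unfolding * unfolding r m by simp
      next
        case False
        then have "Suc n mod p = Suc ?n0" "Suc n div p = ?n1"
          by (simp_all add: mod_Suc div_Suc)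
        then show ?thesis
          unfolding * unfolding r m by simp
      qed
    next
      case True
      then have m: "Suc m mod p = 0" "Suc m div p = Suc ?m1"
        by (simp_all add: mod_Suc div_Suc)
      have q1: "q powi (- int (Suc ?m0)) = 1"
        unfolding True by (simp add: power_int_minus root)
      have *: "gbin q (Suc n) r = of_nat (?n1 choose Suc ?m1)
         + q powi (int ?n0 - int ?m0) * (gbin q ?n0 ?m0 * of_nat (?n1 choose ?m1))"
        unfolding step Suc.IH[of "Suc m"] m q1 by simp
      show ?thesis
      proof (cases "Suc ?n0 = p")
        case True
        then have "?n0 = ?m0" using \<open>Suc ?m0 = p\<close> by linarith
        moreover have "Suc n mod p = 0" "Suc n div p = Suc ?n1"
          using True by (simp_all add: mod_Suc div_Suc)
        ultimately show ?thesis
          unfolding * unfolding r m by simp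
      next
        case False
        then have "?n0 < ?m0" using \<open>Suc ?m0 = p\<close> lt by linarith
        moreover have "Suc n div p = ?n1"
          using False by (simp add: div_Suc mod_Suc)
        ultimately show ?thesis
          unfolding * unfolding r m by (simp add: gbin_eq_0)
      qed
    qed
  qed
qed

lemma gbin_root_eq_0: "n mod p < r mod p \<Longrightarrow> gbin q n r = 0"
  by (subst gbin_lucas) (simp add: gbin_eq_0)

lemma gbin_root_neq_0: "r mod p \<le> n mod p \<Longrightarrow> r \<le> n \<Longrightarrow> gbin q n r \<noteq> 0"
  by (subst gbin_lucas) (use p in \<open>simp add: gbin_root_nonzero div_le_mono not_less\<close>)

end


section \<open>Specialization of Laurent polynomials\<close>

lemma Fract_power: "Fract P 1 ^ n = Fract (P ^ n) (1 :: complex poly)"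
  by (induction n) (auto simp: One_fract_def)

lemma Fract_1_eq_iff: "Fract P 1 = Fract Q (1 :: complex poly) \<longleftrightarrow> P = Q"
  by (simp add: eq_fract)

lemma qvar_nonzero [simp]: "qvar \<noteq> 0"
  by (simp add: qvar_def Zero_fract_def eq_fract)

lemma qvar_power: "qvar ^ n = Fract (monom 1 n) 1"
  by (simp add: qvar_def Fract_power monom_altdef)

lemma qvar_power_eq_1: "qvar ^ n = 1 \<longleftrightarrow> n = 0"
proof -
  have "qvar ^ n = 1 \<longleftrightarrow> monom 1 n = (1 :: complex poly)"
    by (simp add: qvar_power One_fract_def Fract_1_eq_iff)
  also have "\<dots> \<longleftrightarrow> n = 0"
    by (metis degree_1 degree_monom_eq monom_eq_1 zero_neq_one)
  finally show ?thesis .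
qed

lemma qdiff_qvar_nonzero [simp]: "qdiff qvar k = 0 \<longleftrightarrow> k = 0"
proof -
  have "qvar powi k = 1 \<longleftrightarrow> k = 0" for k
  proof (cases k rule: int_cases2)
    case (nonpos n)
    then show ?thesis
      by (simp add: power_int_minus qvar_power_eq_1)
  qed (simp add: qvar_power_eq_1)
  then show ?thesis
    by (simp add: qdiff_eq_0_iff)
qed

lemma qint_eq: "qint k = qdiff qvar k / qdiff qvar 1"
  by (simp add: qint_def qdiff_def)

lemma qfact_eq: "qfact n = (\<Prod>k=1..n. qdiff qvar (int k)) / qdiff qvar 1 ^ n"
  by (simp add: qfact_def qint_eq prod_dividef)

lemma qfact_nonzero [simp]: "qfact n \<noteq> 0"
  by (auto simp: qfact_eq)

lemma qfact_Suc: "qfact (Suc n) = qfact n * qint (int (Suc n))"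
  by (simp add: qfact_def)

lemma qbinom_eq:
  "qbinom n (int r) = (\<Prod>i<r. qdiff qvar (n - int i)) / (\<Prod>k=1..r. qdiff qvar (int k))"
  by (simp add: qbinom_def qint_eq qfact_eq prod_dividef)

lemma qbinom_eq_gbin: "qbinom (int n) (int r) = gbin qvar n r"
  unfolding qbinom_eq gbin_mult_prod[OF qvar_nonzero, symmetric]
  by simp

lemma laurentE:
  assumes "x \<in> laurent"
  obtains P n where "x = Fract P 1 / qvar ^ n"
  using assms by (auto simp: laurent_def)

lemma laurentI: "Fract P 1 / qvar ^ n \<in> laurent"
  by (auto simp: laurent_def)

lemma laurent_common_denominator:
  "Fract P 1 / qvar ^ n = Fract (P * monom 1 m) 1 / qvar ^ (n + m)"
  by (simp add: power_add qvar_power[of m] divide_simps) (simp add: qvar_power Zero_fract_def eq_fract)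

lemma laurent_add_eq:
  "Fract P 1 / qvar ^ n + Fract Q 1 / qvar ^ m =
    Fract (P * monom 1 m + Q * monom 1 n) 1 / qvar ^ (n + m)"
  by (subst laurent_common_denominator[of P n m], subst laurent_common_denominator[of Q m n])
    (simp add: add.commute[of m n] flip: add_divide_distrib)

lemma laurent_mult_eq:
  "(Fract P 1 / qvar ^ n) * (Fract Q 1 / qvar ^ m) = Fract (P * Q) 1 / qvar ^ (n + m)"
  by (simp add: power_add)

lemma laurent_add: "x \<in> laurent \<Longrightarrow> y \<in> laurent \<Longrightarrow> x + y \<in> laurent"
  by (metis laurentE laurentI laurent_add_eq)

lemma laurent_mult: "x \<in> laurent \<Longrightarrow> y \<in> laurent \<Longrightarrow> x * y \<in> laurent"
  by (metis laurentE laurentI laurent_mult_eq)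

lemma laurent_ratconst: "ratconst c \<in> laurent"
  using laurentI[of "[:c:]" 0] by (simp add: ratconst_def)

lemma ratconst_simps [simp]: "ratconst 0 = 0" "ratconst 1 = 1" "ratconst (- 1) = - 1"
  by (simp_all add: ratconst_def Zero_fract_def One_fract_def one_pCons)

lemma laurent_0: "0 \<in> laurent" and laurent_1: "1 \<in> laurent" and laurent_minus_1: "- 1 \<in> laurent"
  using laurent_ratconst[of 0] laurent_ratconst[of 1] laurent_ratconst[of "- 1"] by simp_all

lemma laurent_uminus: "x \<in> laurent \<Longrightarrow> - x \<in> laurent"
  using laurent_mult[OF laurent_minus_1] by simp

lemma laurent_qvar_powi: "qvar powi k \<in> laurent"
proof (cases k rule: int_cases2)
  case (nonneg n)
  then show ?thesis
    using laurentI[of "monom 1 n" 0] by (simp add: qvar_power)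
next
  case (nonpos n)
  then show ?thesis
    using laurentI[of 1 n] by (simp add: power_int_minus One_fract_def[symmetric] divide_inverse)
qed

lemma laurent_gbin: "gbin qvar n r \<in> laurent"
  by (induction qvar n r rule: gbin.induct)
    (auto simp del: power_int_minus of_nat_Suc
      intro!: laurent_0 laurent_1 laurent_add laurent_mult laurent_qvar_powi)

context
  fixes \<epsilon> :: complex
  assumes eps: "\<epsilon> \<noteq> 0"
begin

text \<open>Two presentations of the same element agree, after clearing denominators, as polynomials, and can
  be evaluated; this is why the description in \<open>value_at\<close> is definite.\<close>

lemma value_at_eq: "value_at \<epsilon> (Fract P 1 / qvar ^ n) = poly P \<epsilon> / \<epsilon> ^ n"
  unfolding value_at_def
proof (rule the_equality)
  fix c assume "\<exists>Q m. Fract P 1 / qvar ^ n = Fract Q 1 / qvar ^ m \<and> c = poly Q \<epsilon> / \<epsilon> ^ m"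
  then obtain Q m where eq: "Fract P 1 / qvar ^ n = Fract Q 1 / qvar ^ m" and c: "c = poly Q \<epsilon> / \<epsilon> ^ m"
    by blast
  from eq have "Fract (P * monom 1 m) 1 = Fract (Q * monom 1 n) 1"
    by (simp add: frac_eq_eq qvar_power Zero_fract_def eq_fract)
  then have "P * monom 1 m = Q * monom 1 n"
    by (simp add: Fract_1_eq_iff)
  then have "poly P \<epsilon> * \<epsilon> ^ m = poly Q \<epsilon> * \<epsilon> ^ n"
    by (metis poly_monom poly_mult mult_1)
  then show "c = poly P \<epsilon> / \<epsilon> ^ n"
    using eps by (simp add: c frac_eq_eq)
qed blast

lemma value_at_add:
  assumes "x \<in> laurent" "y \<in> laurent"
  shows "value_at \<epsilon> (x + y) = value_at \<epsilon> x + value_at \<epsilon> y"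
  using assms by (elim laurentE) (use eps in \<open>hypsubst, simp only: laurent_add_eq value_at_eq, simp add: poly_monom field_simps power_add\<close>)

lemma value_at_mult:
  assumes "x \<in> laurent" "y \<in> laurent"
  shows "value_at \<epsilon> (x * y) = value_at \<epsilon> x * value_at \<epsilon> y"
  using assms by (elim laurentE) (use eps in \<open>hypsubst, simp only: laurent_mult_eq value_at_eq, simp add: power_add\<close>)

lemma value_at_ratconst [simp]: "value_at \<epsilon> (ratconst c) = c"
  using value_at_eq[of "[:c:]" 0] by (simp add: ratconst_def)

lemma value_at_simps [simp]: "value_at \<epsilon> 0 = 0" "value_at \<epsilon> 1 = 1" "value_at \<epsilon> (- 1) = - 1"
  using value_at_ratconst[of 0] value_at_ratconst[of 1] value_at_ratconst[of "- 1"]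
  by simp_all

lemma value_at_uminus: "x \<in> laurent \<Longrightarrow> value_at \<epsilon> (- x) = - value_at \<epsilon> x"
  using value_at_mult[OF laurent_minus_1] by simp

lemma value_at_qvar_powi [simp]: "value_at \<epsilon> (qvar powi k) = \<epsilon> powi k"
proof (cases k rule: int_cases2)
  case (nonneg n)
  then show ?thesis
    using value_at_eq[of "monom 1 n" 0] by (simp add: qvar_power poly_monom)
next
  case (nonpos n)
  then show ?thesis
    using value_at_eq[of 1 n] by (simp add: power_int_minus One_fract_def[symmetric] divide_inverse)
qed

lemma value_at_gbin [simp]: "value_at \<epsilon> (gbin qvar n r) = gbin \<epsilon> n r"
proof (induction n arbitrary: r)
  case 0
  then show ?case by (cases r) auto
next
  case (Suc n)
  then show ?case
    by (cases r) (auto simp del: power_int_minus of_nat_Suc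
      simp: value_at_add value_at_mult laurent_mult laurent_gbin laurent_qvar_powi)
qed

text \<open>Division with remainder by \<open>q - \<epsilon>\<close> in \<open>\<A>\<close>. It shows that after specialization an
  element of \<open>\<A>\<close> acts as the complex number that is its value.\<close>

lemma laurent_eq_value_plus:
  assumes "x \<in> laurent"
  obtains y where "y \<in> laurent" "x = ratconst (value_at \<epsilon> x) + (qvar - ratconst \<epsilon>) * y"
proof -
  obtain P n where x: "x = Fract P 1 / qvar ^ n"
    using assms by (rule laurentE)
  define c where "c = value_at \<epsilon> x"
  have "poly (P - Polynomial.smult c (monom 1 n)) \<epsilon> = 0"
    using eps by (simp add: c_def x value_at_eq poly_monom)
  then obtain Q where "P - Polynomial.smult c (monom 1 n) = [:- \<epsilon>, 1:] * Q"
    by (metis poly_eq_0_iff_dvd dvdE)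
  then have "P = [:c:] * monom 1 n + [:- \<epsilon>, 1:] * Q"
    by (simp add: algebra_simps)
  then have "Fract P 1 = Fract [:c:] 1 * Fract (monom 1 n) 1 + Fract [:- \<epsilon>, 1:] 1 * Fract Q 1"
    by simp
  moreover have "Fract [:- \<epsilon>, 1:] 1 = qvar - ratconst \<epsilon>"
    by (simp add: qvar_def ratconst_def)
  ultimately have "x = ratconst c + (qvar - ratconst \<epsilon>) * (Fract Q 1 / qvar ^ n)"
    unfolding x by (simp add: qvar_power[symmetric] ratconst_def[symmetric] add_divide_distrib)
  with laurentI that show thesis unfolding c_def by blast
qed

end


section \<open>Commutation relations\<close>

text \<open>Scalar multiplication on \<open>U\<^sub>q(sl\<^sub>2)\<close>; a name of its own keeps the simplifier
  from reassociating scalars into products.\<close>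

definition scl :: "ratfun \<Rightarrow> uq \<Rightarrow> uq" where
  "scl a x = uq_scal a * x"

lemma uq_scal_add: "uq_scal (a + b) = uq_scal a + uq_scal b"
  by transfer (rule scal_plus)

lemma uq_scal_mult: "uq_scal (a * b) = uq_scal a * uq_scal b"
  by transfer (rule scal_times)

lemma uq_scal_central: "uq_scal a * x = x * uq_scal a"
  by transfer (rule scal_central)

lemma uq_scal_0 [simp]: "uq_scal 0 = 0"
  by transfer (rule uq_eq.refl)

lemma uq_scal_1 [simp]: "uq_scal 1 = 1"
  by transfer (rule uq_eq.refl)

lemma uq_scal_minus_1 [simp]: "uq_scal (- 1) = - 1"
  using uq_scal_add[of "- 1" 1] by (simp add: eq_neg_iff_add_eq_0)

lemma scl_simps [simp]:
  "scl 0 x = 0" "scl 1 x = x" "scl a 0 = 0" "scl a (scl b x) = scl (a * b) x"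
  "scl a x * y = scl a (x * y)" "x * scl a y = scl a (x * y)"
  "scl a (- x) = - scl a x"
  by (simp_all add: scl_def uq_scal_mult mult.assoc) (metis mult.assoc uq_scal_central)

lemma scl_add_left: "scl (a + b) x = scl a x + scl b x"
  by (simp add: scl_def uq_scal_add semiring_class.distrib_right)

lemma scl_add_right: "scl a (x + y) = scl a x + scl a y"
  by (simp add: scl_def semiring_class.distrib_left)

lemma scl_diff_right: "scl a (x - y) = scl a x - scl a y"
  by (simp add: scl_def right_diff_distrib)

lemma scl_uminus_left: "scl (- a) x = - scl a x"
  by (metis add_eq_0_iff add.right_inverse scl_add_left scl_simps(1))

lemma scl_diff_left: "scl (a - b) x = scl a x - scl b x"
  using scl_add_left[of a "- b" x] by (simp add: scl_uminus_left)

lemma scl_sum_right: "scl a (sum g A) = (\<Sum>i\<in>A. scl a (g i))"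
  by (simp add: scl_def sum_distrib_left)

lemma scl_cancel: "a \<noteq> 0 \<Longrightarrow> scl a x = scl a y \<longleftrightarrow> x = y"
  by (metis left_inverse scl_simps(2,4))

lemma uq_K_Kinv [simp]: "uq_K * uq_Kinv = 1" "uq_Kinv * uq_K = 1"
  by (transfer, rule K_Kinv Kinv_K)+

lemma uq_K_e: "uq_K * uq_e = scl (qvar ^ 2) (uq_e * uq_K)"
proof -
  have "uq_K * uq_e * uq_Kinv = scl (qvar ^ 2) uq_e"
    unfolding scl_def by transfer (rule K_e)
  then have "uq_K * uq_e * uq_Kinv * uq_K = scl (qvar ^ 2) (uq_e * uq_K)"
    by simp
  then show ?thesis by (simp add: mult.assoc)
qed

lemma uq_K_f: "uq_K * uq_f = scl (qvar powi (- 2)) (uq_f * uq_K)"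
proof -
  have "uq_K * uq_f * uq_Kinv = scl (qvar powi (- 2)) uq_f"
    unfolding scl_def by transfer (rule K_f)
  then have "uq_K * uq_f * uq_Kinv * uq_K = scl (qvar powi (- 2)) (uq_f * uq_K)"
    by simp
  then show ?thesis by (simp add: mult.assoc)
qed

lemma uq_Kinv_commute:
  assumes "uq_K * x = scl a (x * uq_K)" "a \<noteq> 0"
  shows "uq_Kinv * x = scl (inverse a) (x * uq_Kinv)"
proof -
  have "uq_Kinv * (uq_K * x) * uq_Kinv = uq_Kinv * (scl a (x * uq_K)) * uq_Kinv"
    by (simp add: assms)
  then have "x * uq_Kinv = scl a (uq_Kinv * x)"
    by (simp add: mult.assoc) (simp flip: mult.assoc)
  then show ?thesis
    using \<open>a \<noteq> 0\<close> by simp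
qed

text \<open>The numerator of \<open>[K; c]\<close>, the analogue of \<open>qdiff\<close> with \<open>K q\<^sup>c\<close> in place of a power of \<open>q\<close>.\<close>

definition kbr :: "int \<Rightarrow> uq" where
  "kbr c = scl (qvar powi c) uq_K - scl (qvar powi (- c)) uq_Kinv"

lemma uq_e_f: "uq_e * uq_f = uq_f * uq_e + scl (1 / qdiff qvar 1) (kbr 0)"
proof -
  have "uq_e * uq_f + - (uq_f * uq_e) =
      uq_scal (1 / (qvar - qvar powi (- 1))) * (uq_K + - uq_Kinv)"
    using e_f unfolding uq_scal_minus_1[symmetric] by transfer simp
  then show ?thesis
    by (simp add: scl_def kbr_def qdiff_def algebra_simps)
qed

lemma uq_e_kbr: "uq_e * kbr c = kbr (c - 2) * uq_e"
proof -
  have "uq_e * uq_K = scl (qvar powi (- 2)) (uq_K * uq_e)"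
    unfolding uq_K_e by (simp add: power_int_minus)
  moreover have "uq_e * uq_Kinv = scl (qvar ^ 2) (uq_Kinv * uq_e)"
    using uq_Kinv_commute[OF uq_K_e] by simp
  ultimately show ?thesis
    by (simp add: kbr_def algebra_simps power_int_add power_int_diff power_int_minus divide_inverse)
qed

lemma kbr_uq_f: "kbr c * uq_f = uq_f * kbr (c - 2)"
proof -
  have "uq_Kinv * uq_f = scl (qvar ^ 2) (uq_f * uq_Kinv)"
    using uq_Kinv_commute[OF uq_K_f] by (simp add: power_int_minus)
  then show ?thesis
    by (simp add: kbr_def algebra_simps uq_K_f power_int_add power_int_diff power_int_minus divide_inverse)
qed

lemma kbr_commute: "kbr c * kbr d = kbr d * kbr c"
  by (simp add: kbr_def algebra_simps scl_diff_right)

text \<open>The identity \<open>[n - t][x - n] + [t][x] = [n][x + t - n]\<close> with \<open>K\<close> inserted into the second factors.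
  It carries both inductions below, with \<open>t = 1\<close> in the one that moves \<open>e\<close> past a divided power of \<open>f\<close>.\<close>

lemma kbr_three_term:
  "scl (qdiff qvar (n - t)) (kbr (x - n)) + scl (qdiff qvar t) (kbr x)
     = scl (qdiff qvar n) (kbr (x + t - n))"
proof -
  have "qdiff qvar (n - t) * qvar powi (x - n) + qdiff qvar t * qvar powi x
      = qdiff qvar n * qvar powi (x + t - n)" for x t n
    by (simp add: qdiff_def algebra_simps flip: power_int_add)
  moreover have "qdiff qvar (n - t) * qvar powi (n - x) + qdiff qvar t * qvar powi (- x)
      = qdiff qvar n * qvar powi (n - (x + t))"
    by (simp add: qdiff_def algebra_simps flip: power_int_add)
  ultimately show ?thesis
    by (simp add: kbr_def scl_diff_right algebra_simps flip: scl_add_left)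
qed

text \<open>\<open>Kbin c t\<close> is the element usually written \<open>[K; c over t]\<close>.\<close>

fun Kbin :: "int \<Rightarrow> nat \<Rightarrow> uq" where
  "Kbin c 0 = 1"
| "Kbin c (Suc t) = scl (1 / qdiff qvar (int (Suc t))) (Kbin c t * kbr (c - int t))"

lemma Kbin_kbr_commute: "Kbin c t * kbr d = kbr d * Kbin c t"
  by (induction t) (auto simp: mult.assoc kbr_commute, simp flip: mult.assoc)

lemma Kbin_Suc_shift: "Kbin (c + 1) (Suc t) = scl (1 / qdiff qvar (int (Suc t))) (kbr (c + 1) * Kbin c t)"
proof (induction t)
  case (Suc t)
  show ?case
    by (subst Kbin.simps, subst Suc) (simp add: mult.assoc mult_ac)
qed simp

lemma uq_e_Kbin: "uq_e * Kbin c t = Kbin (c - 2) t * uq_e"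
proof (induction t)
  case (Suc t)
  have "uq_e * (Kbin c t * kbr (c - int t)) = Kbin (c - 2) t * (uq_e * kbr (c - int t))"
    using Suc by (simp flip: mult.assoc)
  also have "\<dots> = Kbin (c - 2) t * kbr (c - 2 - int t) * uq_e"
    by (simp add: uq_e_kbr mult.assoc algebra_simps)
  finally show ?case by simp
qed simp

lemma uq_Kbin_eq: "uq_Kbin t = Kbin 0 t"
proof (induction t)
  case 0
  show ?case by (simp add: uq_Kbin_def)
next
  case (Suc t)
  have "uq_Kbin (Suc t) = uq_Kbin t * scl (1 / qdiff qvar (int (Suc t))) (kbr (- int t))"
    by (simp add: uq_Kbin_def scl_def kbr_def qdiff_def)
  then show ?case by (simp add: Suc)
qed

lemma uq_dp_0 [simp]: "uq_e_dp 0 = 1" "uq_f_dp 0 = 1"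
  by (simp_all add: uq_e_dp_def uq_f_dp_def qfact_def)

lemma uq_e_uq_e_dp: "uq_e * uq_e_dp r = scl (qint (int (Suc r))) (uq_e_dp (Suc r))"
  and uq_f_dp_uq_f: "uq_f_dp r * uq_f = scl (qint (int (Suc r))) (uq_f_dp (Suc r))"
proof -
  have nz: "qint (int (Suc r)) \<noteq> 0"
    by (simp add: qint_eq)
  show "uq_e * uq_e_dp r = scl (qint (int (Suc r))) (uq_e_dp (Suc r))"
    using nz by (simp add: uq_e_dp_def qfact_Suc scl_def[symmetric])
  show "uq_f_dp r * uq_f = scl (qint (int (Suc r))) (uq_f_dp (Suc r))"
    using nz by (simp add: uq_f_dp_def qfact_Suc scl_def[symmetric] power_commutes)
qed

lemma uq_e_uq_f_dp:
  "uq_e * uq_f_dp (Suc s) = uq_f_dp (Suc s) * uq_e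
     + scl (1 / qdiff qvar 1) (uq_f_dp s * kbr (- int s))"
proof (induction s)
  case 0
  show ?case by (simp add: uq_f_dp_def qfact_def qint_eq uq_e_f)
next
  case (Suc s)
  let ?n = "int (Suc (Suc s))" and ?d = "qdiff qvar 1"
  have "scl (qint ?n) (uq_e * uq_f_dp (Suc (Suc s))) = uq_e * uq_f_dp (Suc s) * uq_f"
    by (simp add: mult.assoc uq_f_dp_uq_f)
  also have "\<dots> = uq_f_dp (Suc s) * (uq_e * uq_f) + scl (1 / ?d) (uq_f_dp s * (kbr (- int s) * uq_f))"
    by (simp add: Suc.IH semiring_class.distrib_right mult.assoc)
  also have "\<dots> = (uq_f_dp (Suc s) * uq_f) * uq_e + scl (1 / ?d) (uq_f_dp (Suc s) * kbr 0)
      + scl (1 / ?d) ((uq_f_dp s * uq_f) * kbr (- int s - 2))"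
    by (simp add: uq_e_f kbr_uq_f semiring_class.distrib_left mult.assoc add.assoc)
  also have "\<dots> = scl (qint ?n) (uq_f_dp (Suc (Suc s)) * uq_e)
      + uq_f_dp (Suc s) * (scl (1 / ?d) (kbr 0) + scl (1 / ?d * qint (?n - 1)) (kbr (- int s - 2)))"
    by (simp add: uq_f_dp_uq_f semiring_class.distrib_left add.assoc)
  also have "scl (1 / ?d) (kbr 0) + scl (1 / ?d * qint (?n - 1)) (kbr (- int s - 2))
      = scl (1 / ?d * qint ?n) (kbr (- int (Suc s)))"
  proof -
    have "scl (1 / (?d * ?d)) (scl (qdiff qvar (?n - 1)) (kbr (0 - ?n)) + scl ?d (kbr 0))
        = scl (1 / (?d * ?d)) (scl (qdiff qvar ?n) (kbr (0 + 1 - ?n)))"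
      by (simp only: kbr_three_term)
    then show ?thesis
      by (simp add: qint_eq scl_add_right add.commute)
  qed
  finally have "scl (qint ?n) (uq_e * uq_f_dp (Suc (Suc s))) =
      scl (qint ?n) (uq_f_dp (Suc (Suc s)) * uq_e
        + scl (1 / ?d) (uq_f_dp (Suc s) * kbr (- int (Suc s))))"
    by (simp add: scl_add_right mult.commute)
  then show ?case
    by (subst (asm) scl_cancel) (simp_all add: qint_eq)
qed

text \<open>Divided powers of \<open>f\<close> of negative order are \<open>0\<close>, so that the sum in the commutation formula can run
  over a range independent of \<open>s\<close>.\<close>

definition fdp_cut :: "nat \<Rightarrow> nat \<Rightarrow> uq" where
  "fdp_cut s t = (if t \<le> s then uq_f_dp (s - t) else 0)"

lemma uq_e_fdp_cut:
  "uq_e * fdp_cut s t = fdp_cut s t * uq_e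
     + scl (1 / qdiff qvar 1) (fdp_cut s (Suc t) * kbr (1 - int s + int t))"
proof (cases "t < s")
  case True
  then have "s - t = Suc (s - Suc t)" "1 - int s + int t = - int (s - Suc t)"
    by auto
  then show ?thesis
    using True uq_e_uq_f_dp[of "s - Suc t"] by (simp add: fdp_cut_def algebra_simps)
qed (auto simp: fdp_cut_def)

text \<open>Induction on \<open>r\<close>: multiply by \<open>e\<close> on the left and move it to the right through both factors. This
  yields two sums, one with \<open>t\<close> unchanged and one with \<open>t\<close> raised by one; after a shift of the index in
  the second, their terms combine by \<open>kbr_three_term\<close>.\<close>

theorem uq_e_dp_f_dp:
  "uq_e_dp r * uq_f_dp s =
    (\<Sum>t\<le>r. fdp_cut s t * Kbin (2 * int t - int r - int s) t * uq_e_dp (r - t))"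
proof (induction r)
  case 0
  show ?case by (simp add: fdp_cut_def)
next
  case (Suc r)
  let ?d = "qdiff qvar" and ?T = "fdp_cut s" and ?c = "\<lambda>t. 2 * int t - int r - int s"
  have "scl (qint (int (Suc r))) (uq_e_dp (Suc r) * uq_f_dp s) = uq_e * (uq_e_dp r * uq_f_dp s)"
    by (simp add: uq_e_uq_e_dp flip: mult.assoc)
  also have "\<dots> = (\<Sum>t\<le>r. (uq_e * ?T t) * Kbin (?c t) t * uq_e_dp (r - t))"
    by (simp add: Suc.IH sum_distrib_left mult.assoc)
  also have "\<dots> = (\<Sum>t\<le>r. scl (qint (int (Suc r) - int t)) (?T t * Kbin (?c t - 2) t * uq_e_dp (Suc r - t))
     + scl (1 / ?d 1) (?T (Suc t) * kbr (1 - int s + int t) * Kbin (?c t) t * uq_e_dp (r - t)))"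
  proof (intro sum.cong HOL.refl)
    fix t assume "t \<in> {..r}"
    then have t: "Suc r - t = Suc (r - t)" "int (Suc r) - int t = int (Suc (r - t))" by auto
    have "(uq_e * ?T t) * Kbin (?c t) t * uq_e_dp (r - t) =
        ?T t * (uq_e * Kbin (?c t) t) * uq_e_dp (r - t)
        + scl (1 / ?d 1) (?T (Suc t) * kbr (1 - int s + int t) * Kbin (?c t) t * uq_e_dp (r - t))"
      unfolding uq_e_fdp_cut by (simp add: semiring_class.distrib_right mult.assoc)
    also have "?T t * (uq_e * Kbin (?c t) t) * uq_e_dp (r - t)
        = ?T t * Kbin (?c t - 2) t * (uq_e * uq_e_dp (r - t))"
      by (simp add: uq_e_Kbin mult.assoc)
    finally show "(uq_e * ?T t) * Kbin (?c t) t * uq_e_dp (r - t) =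
      scl (qint (int (Suc r) - int t)) (?T t * Kbin (?c t - 2) t * uq_e_dp (Suc r - t))
     + scl (1 / ?d 1) (?T (Suc t) * kbr (1 - int s + int t) * Kbin (?c t) t * uq_e_dp (r - t))"
      unfolding t by (simp add: uq_e_uq_e_dp)
  qed
  \<comment> \<open>The added summand \<open>t = Suc r\<close> of the first sum has the coefficient \<open>[0] = 0\<close>.\<close>
  also have "\<dots> = (\<Sum>t\<le>Suc r. scl (qint (int (Suc r) - int t)) (?T t * Kbin (?c t - 2) t * uq_e_dp (Suc r - t)))
     + (\<Sum>t\<le>r. scl (1 / ?d 1) (?T (Suc t) * kbr (1 - int s + int t) * Kbin (?c t) t * uq_e_dp (r - t)))"
    by (simp add: sum.distrib qint_eq)
  also have "\<dots> = scl (qint (int (Suc r))) (?T 0 * uq_e_dp (Suc r))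
     + (\<Sum>t\<le>r. ?T (Suc t) * (scl (qint (int r - int t)) (Kbin (?c t) (Suc t))
         + scl (1 / ?d 1) (kbr (1 - int s + int t) * Kbin (?c t) t)) * uq_e_dp (r - t))"
    by (subst sum.atMost_Suc_shift) (simp add: sum.distrib semiring_class.distrib_left semiring_class.distrib_right mult.assoc algebra_simps)
  also have "\<dots> = scl (qint (int (Suc r))) (?T 0 * uq_e_dp (Suc r))
     + (\<Sum>t\<le>r. scl (qint (int (Suc r))) (?T (Suc t) * Kbin (?c t + 1) (Suc t) * uq_e_dp (r - t)))"
  proof -
    have "scl (qint (int r - int t)) (Kbin (?c t) (Suc t))
         + scl (1 / ?d 1) (kbr (1 - int s + int t) * Kbin (?c t) t)
         = scl (qint (int (Suc r))) (Kbin (?c t + 1) (Suc t))" for t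
    proof -
      let ?n = "int (Suc r)" and ?t = "int (Suc t)" and ?x = "1 - int s + int t"
      have "scl (1 / (?d ?t * ?d 1)) (scl (?d (?n - ?t)) (kbr (?x - ?n)) + scl (?d ?t) (kbr ?x)) * Kbin (?c t) t
         = scl (1 / (?d ?t * ?d 1)) (scl (?d ?n) (kbr (?x + ?t - ?n))) * Kbin (?c t) t"
        by (simp only: kbr_three_term)
      moreover have "?x - ?n = ?c t - int t" "?x + ?t - ?n = ?c t + 1" "?n - ?t = int r - int t"
        by simp_all
      ultimately show ?thesis
        unfolding Kbin_Suc_shift unfolding Kbin.simps Kbin_kbr_commute
        by (simp add: qint_eq scl_add_right semiring_class.distrib_right mult.commute[of "?d 1"]
            del: of_nat_Suc)
    qed
    then show ?thesis by simp
  qed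
  also have "\<dots> = scl (qint (int (Suc r)))
      (\<Sum>t\<le>Suc r. ?T t * Kbin (2 * int t - int (Suc r) - int s) t * uq_e_dp (Suc r - t))"
    by (subst sum.atMost_Suc_shift) (simp add: scl_sum_right scl_add_right algebra_simps)
  finally show ?case
    by (subst (asm) scl_cancel) (simp_all add: qint_eq)
qed


section \<open>The restricted integral form\<close>

lemma Ures_int_0: "0 \<in> Ures_int" and Ures_int_1: "1 \<in> Ures_int"
  using Ures_int.scal[OF laurent_0] Ures_int.scal[OF laurent_1] by simp_all

lemma Ures_int_scl: "a \<in> laurent \<Longrightarrow> x \<in> Ures_int \<Longrightarrow> scl a x \<in> Ures_int"
  unfolding scl_def by (intro Ures_int.times Ures_int.scal)

lemma Ures_int_uminus: "x \<in> Ures_int \<Longrightarrow> - x \<in> Ures_int"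
  using Ures_int_scl[OF laurent_minus_1] by (simp add: scl_def)

lemma Ures_int_diff: "x \<in> Ures_int \<Longrightarrow> y \<in> Ures_int \<Longrightarrow> x - y \<in> Ures_int"
  using Ures_int.plus[OF _ Ures_int_uminus] by fastforce

lemma Ures_int_sum: "(\<And>i. i \<in> A \<Longrightarrow> g i \<in> Ures_int) \<Longrightarrow> sum g A \<in> Ures_int"
  by (induction A rule: infinite_finite_induct) (auto intro: Ures_int_0 Ures_int.plus)

lemma Ures_int_dp: "uq_e_dp r \<in> Ures_int" "uq_f_dp r \<in> Ures_int"
  by (cases r; simp add: Ures_int_1 Ures_int.e_dp Ures_int.f_dp)+

lemma Kbin_pascal:
  "Kbin (c + 1) (Suc t) = scl (qvar powi (- int (Suc t))) (Kbin c (Suc t))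
     + scl (qvar powi (c - int t)) (uq_K * Kbin c t)"
proof -
  let ?t = "int (Suc t)"
  have "kbr (c + 1) = scl (qvar powi (- ?t)) (kbr (c - int t)) + scl (qdiff qvar ?t * qvar powi (c - int t)) uq_K"
    by (simp add: kbr_def qdiff_def scl_diff_right left_diff_distrib scl_diff_left algebra_simps flip: power_int_add)
  then show ?thesis
    unfolding Kbin_Suc_shift unfolding Kbin.simps Kbin_kbr_commute
    by (simp add: scl_add_right semiring_class.distrib_right mult.commute del: of_nat_Suc)
qed

text \<open>For \<open>c = 0\<close>, the commutation formula for \<open>e\<^sup>(\<^sup>t\<^sup>)\<close> and \<open>f\<^sup>(\<^sup>t\<^sup>)\<close> exhibits \<open>Kbin 0 t\<close> as its last summand,
  all others containing some \<open>Kbin c j\<close> with \<open>j < t\<close>. The Pascal rule then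
  changes \<open>c\<close> by one in either direction, again at the cost of a smaller second index.\<close>

lemma Ures_int_Kbin: "Kbin c t \<in> Ures_int"
proof (induction t arbitrary: c rule: less_induct)
  case (less t)
  have base: "Kbin 0 t \<in> Ures_int"
  proof -
    let ?g = "\<lambda>j. fdp_cut t j * Kbin (2 * int j - int t - int t) j * uq_e_dp (t - j)"
    have "(\<Sum>j\<le>t. ?g j) = Kbin 0 t + (\<Sum>j<t. ?g j)"
      by (simp add: fdp_cut_def flip: lessThan_Suc_atMost)
    then have "Kbin 0 t = uq_e_dp t * uq_f_dp t - (\<Sum>j<t. ?g j)"
      by (simp add: uq_e_dp_f_dp)
    also have "\<dots> \<in> Ures_int"
      using less by (intro Ures_int_diff Ures_int_sum Ures_int.times)
        (auto simp: fdp_cut_def Ures_int_dp Ures_int_0)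
    finally show ?thesis .
  qed
  show ?case
  proof (cases t)
    case (Suc u)
    have K: "scl (qvar powi (x - int u)) (uq_K * Kbin x u) \<in> Ures_int" for x
      using less[of u x] Suc by (intro Ures_int_scl Ures_int.times Ures_int.K laurent_qvar_powi) auto
    show ?thesis
    proof (induction c rule: int_induct[of _ 0])
      case base
      show ?case by (rule \<open>Kbin 0 t \<in> Ures_int\<close>)
    next
      case (step1 x)
      then show ?case
        unfolding Suc Kbin_pascal by (intro Ures_int.plus K Ures_int_scl laurent_qvar_powi)
    next
      case (step2 x)
      have "Kbin (x - 1) t = scl (qvar powi int (Suc u)) (Kbin x t - scl (qvar powi (x - 1 - int u)) (uq_K * Kbin (x - 1) u))"
        using Kbin_pascal[of "x - 1" u] by (simp add: Suc power_int_minus scl_diff_right del: of_nat_Suc power_int_of_nat)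
      also have "\<dots> \<in> Ures_int"
        using step2 by (intro Ures_int_scl Ures_int_diff K laurent_qvar_powi)
      finally show ?case .
    qed
  qed (simp add: Ures_int_1)
qed

lemma Ures_int_uq_Kbin: "uq_Kbin t \<in> Ures_int"
  by (simp add: uq_Kbin_eq Ures_int_Kbin)

lemma Ures_int_power: "x \<in> Ures_int \<Longrightarrow> x ^ n \<in> Ures_int"
  by (induction n) (auto intro: Ures_int.times Ures_int_1)

lemma UresA_simps [simp]:
  "carrier UresA = Ures_int" "x \<otimes>\<^bsub>UresA\<^esub> y = x * y" "x \<oplus>\<^bsub>UresA\<^esub> y = x + y"
  "\<one>\<^bsub>UresA\<^esub> = 1" "\<zero>\<^bsub>UresA\<^esub> = 0"
  by (simp_all add: UresA_def)

lemma ring_UresA: "ring UresA"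
proof (rule ringI)
  show "abelian_group UresA"
    by (rule abelian_groupI)
      (auto simp: add.assoc add.commute Ures_int.plus Ures_int_0
        intro!: bexI[of _ "- x" for x] Ures_int_uminus)
  show "Group.monoid UresA"
    by (rule Group.monoidI) (auto simp: mult.assoc Ures_int.times Ures_int_1)
qed (auto simp: semiring_class.distrib_left semiring_class.distrib_right)

context
  fixes \<epsilon> :: complex
begin

lemma spec_ideal_eq: "spec_ideal \<epsilon> = scl (qvar - ratconst \<epsilon>) ` Ures_int"
  by (auto simp: spec_ideal_def scl_def)

lemma q_minus_eps_laurent: "qvar - ratconst \<epsilon> \<in> laurent"
  using laurent_add[OF laurent_qvar_powi[of 1] laurent_uminus[OF laurent_ratconst[of \<epsilon>]]] by simp

lemma spec_ideal_subset: "spec_ideal \<epsilon> \<subseteq> Ures_int"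
  unfolding spec_ideal_eq by (auto intro: Ures_int_scl q_minus_eps_laurent)

lemma UresA_minus: "x \<in> Ures_int \<Longrightarrow> \<ominus>\<^bsub>UresA\<^esub> x = - x"
proof -
  interpret ring UresA by (rule ring_UresA)
  show "x \<in> Ures_int \<Longrightarrow> \<ominus>\<^bsub>UresA\<^esub> x = - x"
    using minus_equality[of "- x" x] by (simp add: Ures_int_uminus)
qed

lemma ideal_spec_ideal: "ideal (spec_ideal \<epsilon>) UresA"
proof (rule idealI[OF ring_UresA])
  interpret ring UresA by (rule ring_UresA)
  show "subgroup (spec_ideal \<epsilon>) (add_monoid UresA)"
  proof (rule add.subgroupI)
    show "spec_ideal \<epsilon> \<noteq> {}" unfolding spec_ideal_eq using Ures_int_0 by auto
  next
    fix x assume "x \<in> spec_ideal \<epsilon>"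
    then show "\<ominus>\<^bsub>UresA\<^esub> x \<in> spec_ideal \<epsilon>"
      unfolding spec_ideal_eq
      by (auto simp: UresA_minus Ures_int_scl q_minus_eps_laurent simp flip: scl_simps(7) intro: Ures_int_uminus)
  next
    fix x y assume "x \<in> spec_ideal \<epsilon>" "y \<in> spec_ideal \<epsilon>"
    then show "x \<oplus>\<^bsub>UresA\<^esub> y \<in> spec_ideal \<epsilon>"
      unfolding spec_ideal_eq by (auto simp flip: scl_add_right intro: Ures_int.plus)
  qed (use spec_ideal_subset in auto)
qed (auto simp: spec_ideal_eq intro: Ures_int.times)

lemma ring_Ures: "ring (Ures \<epsilon>)"
  unfolding Ures_def by (rule ideal.quotient_is_ring[OF ideal_spec_ideal])

lemma carrier_Ures: "carrier (Ures \<epsilon>) = spec \<epsilon> ` Ures_int"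
  by (auto simp: Ures_def FactRing_def A_RCOSETS_def' spec_def)

lemma spec_hom: "spec \<epsilon> \<in> ring_hom UresA (Ures \<epsilon>)"
  using ideal.rcos_ring_hom[OF ideal_spec_ideal] by (simp add: Ures_def spec_def[abs_def])

lemma spec_mult: "x \<in> Ures_int \<Longrightarrow> y \<in> Ures_int \<Longrightarrow> spec \<epsilon> x \<otimes>\<^bsub>Ures \<epsilon>\<^esub> spec \<epsilon> y = spec \<epsilon> (x * y)"
  and spec_add: "x \<in> Ures_int \<Longrightarrow> y \<in> Ures_int \<Longrightarrow> spec \<epsilon> x \<oplus>\<^bsub>Ures \<epsilon>\<^esub> spec \<epsilon> y = spec \<epsilon> (x + y)"
  and spec_one: "\<one>\<^bsub>Ures \<epsilon>\<^esub> = spec \<epsilon> 1"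
  and spec_closed: "x \<in> Ures_int \<Longrightarrow> spec \<epsilon> x \<in> carrier (Ures \<epsilon>)"
  using ring_hom_mult[OF spec_hom] ring_hom_add[OF spec_hom] ring_hom_one[OF spec_hom]
    ring_hom_closed[OF spec_hom] by simp_all

lemma spec_eq_iff:
  assumes "x \<in> Ures_int" "y \<in> Ures_int"
  shows "spec \<epsilon> x = spec \<epsilon> y \<longleftrightarrow> x - y \<in> spec_ideal \<epsilon>"
proof -
  interpret ideal "spec_ideal \<epsilon>" UresA by (rule ideal_spec_ideal)
  have "x \<ominus>\<^bsub>UresA\<^esub> y = x - y"
    using assms by (simp add: a_minus_def UresA_minus)
  then show ?thesis
    unfolding spec_def using assms
    by (metis UresA_simps(1) ideal_spec_ideal ring_UresA ring.quotient_eq_iff_same_a_r_cos)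
qed

lemma spec_laurent:
  assumes "\<epsilon> \<noteq> 0" "a \<in> laurent"
  shows "spec \<epsilon> (uq_scal a) = spec_scal \<epsilon> (value_at \<epsilon> a)"
proof -
  obtain y where y: "y \<in> laurent" "a = ratconst (value_at \<epsilon> a) + (qvar - ratconst \<epsilon>) * y"
    using laurent_eq_value_plus[OF assms] .
  then have "uq_scal a = uq_scal (ratconst (value_at \<epsilon> a)) + scl (qvar - ratconst \<epsilon>) (uq_scal y)"
    by (metis scl_def uq_scal_add uq_scal_mult)
  then show ?thesis
    unfolding spec_scal_def using y(1) assms(2)
    by (subst spec_eq_iff) (auto simp: spec_ideal_eq Ures_int.scal laurent_ratconst Ures_int.plus Ures_int_scl q_minus_eps_laurent)
qed

end


section \<open>The generic Fock representation\<close>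

text \<open>A function \<open>\<phi>\<close> is the family of coordinates of a vector with respect to the \<open>g(a, b)\<close>, so that \<open>e\<close>
  and \<open>f\<close>, which move basis vectors one way, move arguments the other way. All functions are admitted:
  each coordinate of the image depends on one coordinate only, and finiteness of the support
  is irrelevant to the relations.\<close>

primrec gen_op :: "gen \<Rightarrow> (nat \<times> nat \<Rightarrow> ratfun) \<Rightarrow> nat \<times> nat \<Rightarrow> ratfun" where
  "gen_op GE \<phi> = (\<lambda>(a, b). qint (int (Suc b)) * \<phi> (Suc a, Suc b))"
| "gen_op GF \<phi> = (\<lambda>(a, b). if a = 0 \<or> b = 0 then 0 else - qint (int a) * \<phi> (a - 1, b - 1))"
| "gen_op GK \<phi> = (\<lambda>(a, b). qvar powi (- int (Suc (a + b))) * \<phi> (a, b))"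
| "gen_op GKinv \<phi> = (\<lambda>(a, b). qvar powi (int (Suc (a + b))) * \<phi> (a, b))"

primrec expr_op :: "expr \<Rightarrow> (nat \<times> nat \<Rightarrow> ratfun) \<Rightarrow> nat \<times> nat \<Rightarrow> ratfun" where
  "expr_op (Gen g) \<phi> = gen_op g \<phi>"
| "expr_op (Scal c) \<phi> = (\<lambda>k. c * \<phi> k)"
| "expr_op (Plus x y) \<phi> = (\<lambda>k. expr_op x \<phi> k + expr_op y \<phi> k)"
| "expr_op (Times x y) \<phi> = expr_op x (expr_op y \<phi>)"

lemma expr_op_add: "expr_op x (\<lambda>k. \<phi> k + \<psi> k) = (\<lambda>k. expr_op x \<phi> k + expr_op x \<psi> k)"
proof (induction x arbitrary: \<phi> \<psi>)
  case (Gen g)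
  show ?case by (cases g) (auto simp: fun_eq_iff algebra_simps)
qed (auto simp: algebra_simps)

lemma expr_op_scale: "expr_op x (\<lambda>k. c * \<phi> k) = (\<lambda>k. c * expr_op x \<phi> k)"
proof (induction x arbitrary: \<phi>)
  case (Gen g)
  show ?case by (cases g) (auto simp: fun_eq_iff algebra_simps)
qed (auto simp: algebra_simps)

lemma qint_mult_shift: "qint (x + 1) * qint (y + 1) - qint x * qint y = qint (x + y + 1)"
proof -
  have "qdiff qvar (x + 1) * qdiff qvar (y + 1) - qdiff qvar x * qdiff qvar y
      = qdiff qvar 1 * qdiff qvar (x + y + 1)"
    unfolding qdiff_def power_int_minus by (simp add: power_int_add) (simp add: field_simps)
  then show ?thesis
    unfolding qint_eq times_divide_times_eq diff_divide_distrib[symmetric] by simp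
qed

lemma qint_0 [simp]: "qint 0 = 0" and qint_minus: "qint (- k) = - qint k"
  by (simp_all add: qint_eq qdiff_def) (metis minus_diff_eq minus_divide_left)

lemma qint_1 [simp]: "qint 1 = 1"
  by (simp add: qint_eq)

text \<open>The defining relations. The one between \<open>e\<close> and \<open>f\<close> is \<open>qint_mult_shift\<close>; on the boundary
  \<open>a = 0\<close> or \<open>b = 0\<close>, where the image under \<open>f\<close> has the coordinate \<open>0\<close>, it persists because \<open>[0] = 0\<close>.\<close>

lemma expr_op_cong: "x \<doteq> y \<Longrightarrow> expr_op x = expr_op y"
proof (induction rule: uq_eq.induct)
  case (times_cong x x' y y')
  then show ?case by (intro ext) simp
next
  case K_Kinv
  have "qvar powi (- n) * (qvar powi n * x) = x" for n x
    by (simp add: power_int_minus)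
  then show ?case
    by (intro ext, clarify) (simp only: expr_op.simps gen_op.simps prod.case mult_1)
next
  case Kinv_K
  have "qvar powi n * (qvar powi (- n) * x) = x" for n x
    by (simp add: power_int_minus)
  then show ?case
    by (intro ext, clarify) (simp only: expr_op.simps gen_op.simps prod.case mult_1)
next
  case K_e
  have eq: "qvar powi (- int (Suc (a + b))) * (x * (qvar powi (int (Suc (Suc a + Suc b))) * y))
      = qvar ^ 2 * (x * y)" for a b x y
  proof -
    have "qvar powi (- int (Suc (a + b))) * qvar powi (int (Suc (Suc a + Suc b))) = qvar powi 2"
      unfolding power_int_add[OF disjI1[OF qvar_nonzero], symmetric] by simp
    then show ?thesis by simp
  qed
  show ?case
    by (intro ext, clarify) (simp only: expr_op.simps gen_op.simps prod.case eq)
next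
  case K_f
  have eq: "qvar powi (- int (Suc (a + b))) * (x * (qvar powi (int (Suc (a - 1 + (b - 1)))) * y))
      = qvar powi (- 2) * (x * y)" if "\<not> (a = 0 \<or> b = 0)" for a b x y
  proof -
    have "- int (Suc (a + b)) + int (Suc (a - 1 + (b - 1))) = - 2"
      using that by auto
    then have "qvar powi (- int (Suc (a + b))) * qvar powi (int (Suc (a - 1 + (b - 1)))) = qvar powi (- 2)"
      unfolding power_int_add[OF disjI1[OF qvar_nonzero], symmetric] by simp
    then show ?thesis by (metis (no_types, opaque_lifting) mult.assoc mult.left_commute)
  qed
  show ?case
    by (intro ext, clarify, rename_tac \<phi> a b, case_tac "a = 0 \<or> b = 0")
      (simp_all only: expr_op.simps gen_op.simps prod.case eq mult_zero_right if_True if_False simp_thms)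
next
  case e_f
  have eq: "- (qint (int (Suc b)) * qint (int (Suc a))) + qint (int a) * qint (int b)
      = 1 / (qvar - qvar powi (- 1)) * (qvar powi (- int (Suc (a + b))) - qvar powi (int (Suc (a + b))))" for a b
  proof -
    have "1 / (qvar - qvar powi (- 1)) * (qvar powi (- int (Suc (a + b))) - qvar powi (int (Suc (a + b))))
       = qint (- int (Suc (a + b)))"
      by (simp add: qint_def del: of_nat_Suc)
    also have "\<dots> = - qint (int a + int b + 1)"
      unfolding qint_minus by (simp add: add_ac)
    finally show ?thesis
      unfolding qint_mult_shift[symmetric] by (simp add: algebra_simps)
  qed
  show ?case
  proof (intro ext, clarify)
    fix \<phi> :: "nat \<times> nat \<Rightarrow> ratfun" and a b
    have "qint (int (Suc b)) * (- qint (int (Suc a)) * \<phi> (a, b))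
        + - 1 * (if a = 0 \<or> b = 0 then 0 else - qint (int a) * (qint (int (Suc (b - 1))) * \<phi> (Suc (a - 1), Suc (b - 1))))
       = (- (qint (int (Suc b)) * qint (int (Suc a))) + qint (int a) * qint (int b)) * \<phi> (a, b)"
      by (auto simp: algebra_simps)
    also have "\<dots> = 1 / (qvar - qvar powi (- 1)) *
       (qvar powi (- int (Suc (a + b))) * \<phi> (a, b) + - 1 * (qvar powi (int (Suc (a + b))) * \<phi> (a, b)))"
      unfolding eq by (simp add: algebra_simps)
    finally show "expr_op (Plus (Times (Gen GE) (Gen GF)) (Times (Scal (- 1)) (Times (Gen GF) (Gen GE)))) \<phi> (a, b)
      = expr_op (Times (Scal (1 / (qvar - qvar powi (- 1)))) (Plus (Gen GK) (Times (Scal (- 1)) (Gen GKinv)))) \<phi> (a, b)"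
      by (simp only: expr_op.simps gen_op.simps prod.case nat.distinct(2) simp_thms if_False diff_Suc_1)
  qed
qed (simp_all add: fun_eq_iff algebra_simps expr_op_add expr_op_scale)

lift_definition rep :: "uq \<Rightarrow> (nat \<times> nat \<Rightarrow> ratfun) \<Rightarrow> nat \<times> nat \<Rightarrow> ratfun" is expr_op
  by (rule expr_op_cong)

lemma rep_plus: "rep (x + y) \<phi> k = rep x \<phi> k + rep y \<phi> k"
  by transfer simp

lemma rep_times: "rep (x * y) \<phi> = rep x (rep y \<phi>)"
  by transfer simp

lemma rep_scal: "rep (uq_scal c) \<phi> k = c * \<phi> k"
  by transfer simp

lemma rep_one: "rep 1 \<phi> = \<phi>"
  by transfer simp

lemma rep_scl: "rep (scl c x) \<phi> k = c * rep x \<phi> k"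
  by (simp add: scl_def rep_times rep_scal)

lemma rep_add: "rep x (\<lambda>k. \<phi> k + \<psi> k) = (\<lambda>k. rep x \<phi> k + rep x \<psi> k)"
  by transfer (rule expr_op_add)

lemma rep_gen:
  "rep uq_e = gen_op GE" "rep uq_f = gen_op GF" "rep uq_K = gen_op GK" "rep uq_Kinv = gen_op GKinv"
  by (transfer, rule ext, simp only: expr_op.simps)+

lemma rep_e: "rep uq_e \<phi> (a, b) = qint (int (Suc b)) * \<phi> (Suc a, Suc b)"
  by (simp add: rep_gen)

lemma rep_f: "rep uq_f \<phi> (a, b) = (if a = 0 \<or> b = 0 then 0 else - qint (int a) * \<phi> (a - 1, b - 1))"
  by (simp add: rep_gen)

lemma rep_K: "rep uq_K \<phi> (a, b) = qvar powi (- int (Suc (a + b))) * \<phi> (a, b)"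
  by (simp add: rep_gen)

lemma rep_Kinv: "rep uq_Kinv \<phi> (a, b) = qvar powi (int (Suc (a + b))) * \<phi> (a, b)"
  by (simp add: rep_gen)

lemma rep_e_dp: "rep (uq_e_dp r) \<phi> (a, b) = gbin qvar (b + r) r * \<phi> (a + r, b + r)"
proof -
  have "rep (uq_e ^ r) \<phi> (a, b) = (\<Prod>i<r. qint (int (b + r) - int i)) * \<phi> (a + r, b + r)"
  proof (induction r arbitrary: a b)
    case (Suc r)
    have "rep (uq_e ^ Suc r) \<phi> (a, b) = qint (int (Suc b)) *
       ((\<Prod>i<r. qint (int (Suc b + r) - int i)) * \<phi> (Suc a + r, Suc b + r))"
      unfolding power_Suc rep_times rep_e Suc ..
    then show ?case by (simp add: algebra_simps)
  qed (simp add: rep_one)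
  then show ?thesis
    by (simp add: uq_e_dp_def rep_times rep_scal qbinom_def flip: qbinom_eq_gbin)
qed

lemma rep_f_dp:
  "rep (uq_f_dp r) \<phi> (a, b) =
    (if r \<le> a \<and> r \<le> b then (- 1) ^ r * gbin qvar a r * \<phi> (a - r, b - r) else 0)"
proof -
  have "rep (uq_f ^ r) \<phi> (a, b) = (if r \<le> a \<and> r \<le> b
     then (- 1) ^ r * (\<Prod>i<r. qint (int a - int i)) * \<phi> (a - r, b - r) else 0)"
  proof (induction r arbitrary: a b)
    case (Suc r)
    have "rep (uq_f ^ Suc r) \<phi> (a, b) = (if a = 0 \<or> b = 0 then 0 else - qint (int a) *
       (if r \<le> a - 1 \<and> r \<le> b - 1
        then (- 1) ^ r * (\<Prod>i<r. qint (int (a - 1) - int i)) * \<phi> (a - 1 - r, b - 1 - r) else 0))"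
      unfolding power_Suc rep_times rep_f Suc ..
    then show ?case
      by (cases a; cases b) (simp_all add: prod.lessThan_Suc_shift del: prod.lessThan_Suc)
  qed (simp add: rep_one)
  then show ?thesis
    by (simp add: uq_f_dp_def rep_times rep_scal qbinom_def flip: qbinom_eq_gbin)
qed

lemma rep_K_power: "rep (uq_K ^ n) \<phi> (a, b) = (qvar powi (- int (Suc (a + b)))) ^ n * \<phi> (a, b)"
  by (induction n) (simp_all add: rep_one rep_times rep_K del: of_nat_Suc)

lemma rep_Kinv_power: "rep (uq_Kinv ^ n) \<phi> (a, b) = (qvar powi (int (Suc (a + b)))) ^ n * \<phi> (a, b)"
  by (induction n) (simp_all add: rep_one rep_times rep_Kinv del: of_nat_Suc)

lemma rep_kbr: "rep (kbr c) \<phi> (a, b) = qdiff qvar (c - int (Suc (a + b))) * \<phi> (a, b)"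
proof -
  have "kbr c = scl (qvar powi c) uq_K + scl (- (qvar powi (- c))) uq_Kinv"
    by (simp add: kbr_def scl_uminus_left)
  then have "rep (kbr c) \<phi> (a, b) = (qvar powi c * qvar powi (- int (Suc (a + b)))
      - qvar powi (- c) * qvar powi (int (Suc (a + b)))) * \<phi> (a, b)"
    by (simp only: rep_plus rep_scl rep_K rep_Kinv) (simp only: algebra_simps minus_mult_left[symmetric] diff_conv_add_uminus)
  also have "qvar powi c * qvar powi (- n) - qvar powi (- c) * qvar powi n = qdiff qvar (c - n)" for n
    by (simp add: qdiff_def flip: power_int_add)
  finally show ?thesis .
qed

lemma rep_uq_Kbin:
  "rep (uq_Kbin t) \<phi> (a, b) = qbinom (- int (Suc (a + b))) (int t) * \<phi> (a, b)"
  unfolding uq_Kbin_eq qbinom_eq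
proof (induction t arbitrary: \<phi>)
  case (Suc t)
  have "qdiff qvar (- int t - int (Suc (a + b))) = qdiff qvar (- int (Suc (a + b)) - int t)"
    by (rule arg_cong) simp
  then show ?case
    by (simp add: rep_scl rep_times rep_kbr Suc mult_ac del: of_nat_Suc)
qed (simp add: rep_one)


section \<open>Specialization of the Fock representation\<close>

text \<open>The generators act by weighted shifts; these are the properties of weighted shifts with
  coefficients in \<open>\<A>\<close> that survive sums and products. The second says that the operator induces one
  on specialized vectors, which is what makes the specialized action multiplicative.\<close>

definition specializable :: "complex \<Rightarrow> ((nat \<times> nat \<Rightarrow> ratfun) \<Rightarrow> nat \<times> nat \<Rightarrow> ratfun) \<Rightarrow> bool" where
  "specializable \<epsilon> T \<longleftrightarrow>
    (\<forall>\<phi>. range \<phi> \<subseteq> laurent \<longrightarrow> range (T \<phi>) \<subseteq> laurent) \<and>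
    (\<forall>\<phi> \<psi>. range \<phi> \<subseteq> laurent \<and> range \<psi> \<subseteq> laurent \<and> value_at \<epsilon> \<circ> \<phi> = value_at \<epsilon> \<circ> \<psi> \<longrightarrow>
      value_at \<epsilon> \<circ> T \<phi> = value_at \<epsilon> \<circ> T \<psi>) \<and>
    (\<forall>\<phi>. finite {k. \<phi> k \<noteq> 0} \<longrightarrow> finite {k. T \<phi> k \<noteq> 0})"

context
  fixes \<epsilon> :: complex
  assumes eps: "\<epsilon> \<noteq> 0"
begin

lemma specializable_range:
  assumes "specializable \<epsilon> T" "range \<phi> \<subseteq> laurent"
  shows "range (T \<phi>) \<subseteq> laurent"
  using assms(1)[unfolded specializable_def, THEN conjunct1, rule_format, OF assms(2)] .

lemma specializable_laurent:
  "specializable \<epsilon> T \<Longrightarrow> range \<phi> \<subseteq> laurent \<Longrightarrow> T \<phi> k \<in> laurent"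
  using specializable_range by blast

lemma specializable_value:
  assumes "specializable \<epsilon> T" "range \<phi> \<subseteq> laurent" "range \<psi> \<subseteq> laurent"
    "value_at \<epsilon> \<circ> \<phi> = value_at \<epsilon> \<circ> \<psi>"
  shows "value_at \<epsilon> \<circ> T \<phi> = value_at \<epsilon> \<circ> T \<psi>"
  by (rule assms(1)[unfolded specializable_def, THEN conjunct2, THEN conjunct1, rule_format])
    (intro conjI assms(2-4))

lemma specializable_finite:
  assumes "specializable \<epsilon> T" "finite {k. \<phi> k \<noteq> 0}"
  shows "finite {k. T \<phi> k \<noteq> 0}"
  using assms(1)[unfolded specializable_def, THEN conjunct2, THEN conjunct2, rule_format, OF assms(2)] .

lemma specializableI:
  assumes "\<And>\<phi> k. range \<phi> \<subseteq> laurent \<Longrightarrow> T \<phi> k \<in> laurent"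
    and "\<And>\<phi> \<psi>. range \<phi> \<subseteq> laurent \<Longrightarrow> range \<psi> \<subseteq> laurent \<Longrightarrow>
      value_at \<epsilon> \<circ> \<phi> = value_at \<epsilon> \<circ> \<psi> \<Longrightarrow> value_at \<epsilon> \<circ> T \<phi> = value_at \<epsilon> \<circ> T \<psi>"
    and "\<And>\<phi>. finite {k. \<phi> k \<noteq> 0} \<Longrightarrow> finite {k. T \<phi> k \<noteq> 0}"
  shows "specializable \<epsilon> T"
  unfolding specializable_def using assms
  by (intro conjI allI impI) (rule image_subsetI, simp, simp, simp)

lemma specializable_weighted_shift:
  assumes T: "\<And>\<phi> k. T \<phi> k = c k * \<phi> (\<sigma> k)"
    and c: "\<And>k. c k \<in> laurent" and inj: "inj_on \<sigma> {k. c k \<noteq> 0}"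
  shows "specializable \<epsilon> T"
  unfolding specializable_def
proof (intro conjI allI impI)
  fix \<phi> :: "nat \<times> nat \<Rightarrow> ratfun" assume "range \<phi> \<subseteq> laurent"
  then show "range (T \<phi>) \<subseteq> laurent"
    by (auto simp: T intro!: laurent_mult c)
next
  fix \<phi> \<psi> :: "nat \<times> nat \<Rightarrow> ratfun"
  assume *: "range \<phi> \<subseteq> laurent \<and> range \<psi> \<subseteq> laurent \<and> value_at \<epsilon> \<circ> \<phi> = value_at \<epsilon> \<circ> \<psi>"
  then have "value_at \<epsilon> (\<phi> k) = value_at \<epsilon> (\<psi> k)" "\<phi> k \<in> laurent" "\<psi> k \<in> laurent" for k
    by (auto dest: comp_eq_dest)
  then show "value_at \<epsilon> \<circ> T \<phi> = value_at \<epsilon> \<circ> T \<psi>"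
    by (simp add: fun_eq_iff T value_at_mult[OF eps] c)
next
  fix \<phi> :: "nat \<times> nat \<Rightarrow> ratfun" assume fin: "finite {k. \<phi> k \<noteq> 0}"
  have "{k. T \<phi> k \<noteq> 0} = \<sigma> -` {k. \<phi> k \<noteq> 0} \<inter> {k. c k \<noteq> 0}"
    by (auto simp: T)
  then show "finite {k. T \<phi> k \<noteq> 0}"
    using finite_vimage_IntI[OF fin inj] by simp
qed

lemma specializable_rep:
  assumes "u \<in> Ures_int"
  shows "specializable \<epsilon> (rep u)"
  using assms
proof induction
  case (scal a)
  show ?case
    by (rule specializable_weighted_shift[where c = "\<lambda>_. a" and \<sigma> = "\<lambda>k. k"]) (auto simp: rep_scal scal)
next
  case K
  show ?case
    by (rule specializable_weighted_shift[where c = "\<lambda>(a, b). qvar powi (- int (Suc (a + b)))" and \<sigma> = "\<lambda>k. k"])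
      (auto simp: rep_K laurent_qvar_powi simp del: of_nat_Suc power_int_minus)
next
  case Kinv
  show ?case
    by (rule specializable_weighted_shift[where c = "\<lambda>(a, b). qvar powi (int (Suc (a + b)))" and \<sigma> = "\<lambda>k. k"])
      (auto simp: rep_Kinv laurent_qvar_powi simp del: of_nat_Suc power_int_of_nat)
next
  case (e_dp r)
  show ?case
    by (rule specializable_weighted_shift[where c = "\<lambda>(a, b). gbin qvar (b + r) r" and \<sigma> = "\<lambda>(a, b). (a + r, b + r)"])
      (auto simp: rep_e_dp laurent_gbin inj_on_def)
next
  case (f_dp r)
  have *: "(- 1) ^ r * gbin qvar a r \<in> laurent" for a
    by (cases "even r") (auto simp: laurent_gbin laurent_uminus)
  show ?case
  proof (rule specializable_weighted_shift)
    let ?c = "\<lambda>(a, b). if r \<le> a \<and> r \<le> b then (- 1) ^ r * gbin qvar a r else 0"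
      and ?\<sigma> = "\<lambda>(a, b). (a - r, b - r)"
    fix k
    show "rep (uq_f_dp r) \<phi> k = ?c k * \<phi> (?\<sigma> k)" for \<phi>
      by (cases k) (simp add: rep_f_dp)
    show "?c k \<in> laurent"
      by (cases k) (simp add: * laurent_0)
    show "inj_on ?\<sigma> {k. ?c k \<noteq> 0}"
    proof (rule inj_on_subset)
      show "inj_on ?\<sigma> {(a, b). r \<le> a \<and> r \<le> b}"
        by (rule inj_onI) (clarsimp simp: eq_diff_iff)
      show "{k. ?c k \<noteq> 0} \<subseteq> {(a, b). r \<le> a \<and> r \<le> b}"
        by (rule subsetI, case_tac x) (simp split: if_splits)
    qed
  qed
next
  case (plus x y)
  show ?case
  proof (rule specializableI)
    fix \<phi> :: "nat \<times> nat \<Rightarrow> ratfun" assume "finite {k. \<phi> k \<noteq> 0}"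
    then have "finite ({k. rep x \<phi> k \<noteq> 0} \<union> {k. rep y \<phi> k \<noteq> 0})"
      using plus.IH by (simp add: specializable_finite)
    then show "finite {k. rep (x + y) \<phi> k \<noteq> 0}"
      by (rule finite_subset[rotated]) (auto simp: rep_plus)
  next
    fix \<phi> :: "nat \<times> nat \<Rightarrow> ratfun" and k assume "range \<phi> \<subseteq> laurent"
    then show "rep (x + y) \<phi> k \<in> laurent"
      using plus.IH by (simp add: rep_plus laurent_add specializable_laurent)
  next
    fix \<phi> \<psi> :: "nat \<times> nat \<Rightarrow> ratfun"
    assume *: "range \<phi> \<subseteq> laurent" "range \<psi> \<subseteq> laurent" "value_at \<epsilon> \<circ> \<phi> = value_at \<epsilon> \<circ> \<psi>"
    show "value_at \<epsilon> \<circ> rep (x + y) \<phi> = value_at \<epsilon> \<circ> rep (x + y) \<psi>"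
    proof
      fix k
      have "value_at \<epsilon> (rep x \<phi> k) = value_at \<epsilon> (rep x \<psi> k)" "value_at \<epsilon> (rep y \<phi> k) = value_at \<epsilon> (rep y \<psi> k)"
        using comp_eq_dest[OF specializable_value[OF plus.IH(1) *]]
          comp_eq_dest[OF specializable_value[OF plus.IH(2) *]] .
      then show "(value_at \<epsilon> \<circ> rep (x + y) \<phi>) k = (value_at \<epsilon> \<circ> rep (x + y) \<psi>) k"
        using * plus.IH by (simp add: rep_plus value_at_add[OF eps] specializable_laurent)
    qed
  qed
next
  case (times x y)
  show ?case
    unfolding rep_times
  proof (rule specializableI)
    fix \<phi> \<psi> :: "nat \<times> nat \<Rightarrow> ratfun" and k
    show "rep x (rep y \<phi>) k \<in> laurent" if "range \<phi> \<subseteq> laurent"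
      by (rule specializable_laurent[OF times.IH(1) specializable_range[OF times.IH(2) that]])
    show "value_at \<epsilon> \<circ> rep x (rep y \<phi>) = value_at \<epsilon> \<circ> rep x (rep y \<psi>)"
      if "range \<phi> \<subseteq> laurent" "range \<psi> \<subseteq> laurent" "value_at \<epsilon> \<circ> \<phi> = value_at \<epsilon> \<circ> \<psi>"
      by (intro specializable_value[OF times.IH(1)] specializable_value[OF times.IH(2)]
          specializable_range[OF times.IH(2)] that)
    show "finite {k. rep x (rep y \<phi>) k \<noteq> 0}" if "finite {k. \<phi> k \<noteq> 0}"
      using times.IH that by (intro specializable_finite[of "rep x"] specializable_finite[of "rep y"])
  qed
qed

definition lift_fun :: "fock_space \<Rightarrow> nat \<times> nat \<Rightarrow> ratfun" where
  "lift_fun v k = ratconst (Poly_Mapping.lookup v k)"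

text \<open>Lift the coordinates to constants in \<open>\<A>\<close>, act, and evaluate at \<open>\<epsilon>\<close>. Any other lift would give
  the same result.\<close>

definition fock_act :: "uq \<Rightarrow> fock_space \<Rightarrow> fock_space" where
  "fock_act u v = Abs_poly_mapping (\<lambda>k. value_at \<epsilon> (rep u (lift_fun v) k))"

lemma lift_fun_in_laurent: "lift_fun v k \<in> laurent"
  by (simp add: lift_fun_def laurent_ratconst)

lemma lift_fun_laurent: "range (lift_fun v) \<subseteq> laurent"
  by (auto simp: lift_fun_def laurent_ratconst)

lemma lift_fun_value: "value_at \<epsilon> (lift_fun v k) = Poly_Mapping.lookup v k"
  by (simp add: lift_fun_def eps)

lemma lift_fun_add: "lift_fun (v + w) = (\<lambda>k. lift_fun v k + lift_fun w k)"
  by (simp add: lift_fun_def fun_eq_iff lookup_add ratconst_def)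

lemma rep_laurent: "u \<in> Ures_int \<Longrightarrow> rep u (lift_fun v) k \<in> laurent"
  by (rule specializable_laurent[OF specializable_rep lift_fun_laurent])

lemma lookup_fock_act:
  assumes "u \<in> Ures_int"
  shows "Poly_Mapping.lookup (fock_act u v) k = value_at \<epsilon> (rep u (lift_fun v) k)"
proof -
  have "finite {k. lift_fun v k \<noteq> 0}"
    by (rule finite_subset[OF _ finite_keys[of v]]) (auto simp: lift_fun_def in_keys_iff)
  then have "finite {k. rep u (lift_fun v) k \<noteq> 0}"
    by (rule specializable_finite[OF specializable_rep[OF assms]])
  then have "finite {k. value_at \<epsilon> (rep u (lift_fun v) k) \<noteq> 0}"
    by (rule finite_subset[rotated]) (auto simp: eps)
  then show ?thesis
    by (simp add: fock_act_def lookup_Abs_poly_mapping)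
qed

lemma fock_act_plus:
  assumes "x \<in> Ures_int" "y \<in> Ures_int"
  shows "fock_act (x + y) v = fock_act x v + fock_act y v"
  by (rule poly_mapping_eqI)
    (simp add: lookup_fock_act lookup_add assms Ures_int.plus rep_plus value_at_add[OF eps] rep_laurent)

lemma fock_act_add:
  assumes "x \<in> Ures_int"
  shows "fock_act x (v + w) = fock_act x v + fock_act x w"
  by (rule poly_mapping_eqI)
    (simp add: lookup_fock_act lookup_add assms lift_fun_add rep_add value_at_add[OF eps] rep_laurent)

text \<open>The constant lift of \<open>y v\<close> is not \<open>y\<close> applied to the lift of \<open>v\<close>, but the two have the same value at
  \<open>\<epsilon>\<close>, and that is all that the value of \<open>x\<close> applied to them depends on.\<close>

lemma fock_act_times:
  assumes "x \<in> Ures_int" "y \<in> Ures_int"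
  shows "fock_act (x * y) v = fock_act x (fock_act y v)"
proof (rule poly_mapping_eqI)
  fix k
  let ?\<phi> = "rep y (lift_fun v)" and ?\<psi> = "lift_fun (fock_act y v)"
  have "value_at \<epsilon> \<circ> ?\<phi> = value_at \<epsilon> \<circ> ?\<psi>"
    by (intro ext) (simp add: lift_fun_value lookup_fock_act assms)
  then have "value_at \<epsilon> \<circ> rep x ?\<phi> = value_at \<epsilon> \<circ> rep x ?\<psi>"
    by (rule specializable_value[OF specializable_rep[OF assms(1)]
          specializable_range[OF specializable_rep[OF assms(2)] lift_fun_laurent] lift_fun_laurent])
  then show "Poly_Mapping.lookup (fock_act (x * y) v) k = Poly_Mapping.lookup (fock_act x (fock_act y v)) k"
    by (auto dest!: comp_eq_dest[of _ _ _ _ k] simp: lookup_fock_act assms Ures_int.times rep_times)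
qed

lemma fock_act_scal:
  assumes "a \<in> laurent"
  shows "fock_act (uq_scal a) v = fock_scale (value_at \<epsilon> a) v"
  by (rule poly_mapping_eqI)
    (simp add: assms lookup_fock_act Ures_int.scal rep_scal value_at_mult[OF eps]
      lift_fun_value lookup_fock_scale lift_fun_in_laurent)

lemma fock_act_one: "fock_act 1 v = v"
  using fock_act_scal[OF laurent_1] by (simp add: eps)

text \<open>The scalar \<open>q - \<epsilon>\<close>, which generates the ideal, is evaluated to \<open>0\<close>.\<close>

lemma fock_act_spec_cong:
  assumes "x \<in> Ures_int" "y \<in> Ures_int" "spec \<epsilon> x = spec \<epsilon> y"
  shows "fock_act x v = fock_act y v"
proof -
  obtain u where u: "u \<in> Ures_int" "x - y = uq_scal (qvar - ratconst \<epsilon>) * u"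
    using assms by (auto simp: spec_eq_iff spec_ideal_def)
  have "value_at \<epsilon> (qvar - ratconst \<epsilon>) = 0"
    using value_at_add[OF eps laurent_qvar_powi[of 1] laurent_uminus[OF laurent_ratconst[of \<epsilon>]]]
      value_at_qvar_powi[OF eps, of 1]
    by (simp add: value_at_uminus[OF eps laurent_ratconst] eps)
  then have "fock_act (x - y) v = 0"
    using u by (simp add: fock_act_times fock_act_scal Ures_int.scal q_minus_eps_laurent)
  then show ?thesis
    using fock_act_plus[of "x - y" y v] assms by (simp add: Ures_int_diff)
qed

lemma lookup_fock_act_e_dp:
  "Poly_Mapping.lookup (fock_act (uq_e_dp r) v) (a, b) =
    gbin \<epsilon> (b + r) r * Poly_Mapping.lookup v (a + r, b + r)"
  by (simp add: lookup_fock_act Ures_int_dp rep_e_dp value_at_mult[OF eps] laurent_gbin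
      lift_fun_value lift_fun_in_laurent eps)

lemma lookup_fock_act_f_dp:
  "Poly_Mapping.lookup (fock_act (uq_f_dp r) v) (a, b) =
    (if r \<le> a \<and> r \<le> b
     then (- 1) ^ r * gbin \<epsilon> a r * Poly_Mapping.lookup v (a - r, b - r) else 0)"
  by (cases "even r") (simp_all add: lookup_fock_act Ures_int_dp rep_f_dp value_at_mult[OF eps]
      value_at_uminus[OF eps] laurent_gbin laurent_mult lift_fun_value lift_fun_in_laurent eps)

lemma laurent_power: "x \<in> laurent \<Longrightarrow> x ^ n \<in> laurent"
  by (induction n) (auto intro: laurent_1 laurent_mult)

lemma value_at_power: "x \<in> laurent \<Longrightarrow> value_at \<epsilon> (x ^ n) = value_at \<epsilon> x ^ n"
  by (induction n) (simp_all add: eps value_at_mult[OF eps] laurent_power)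

lemma lookup_fock_act_K_power:
  "Poly_Mapping.lookup (fock_act (uq_K ^ n) v) (a, b) =
    (\<epsilon> powi (- int (Suc (a + b)))) ^ n * Poly_Mapping.lookup v (a, b)"
  by (simp add: lookup_fock_act Ures_int_power Ures_int.K rep_K_power value_at_mult[OF eps] laurent_power
      laurent_qvar_powi value_at_power value_at_qvar_powi[OF eps] lift_fun_value lift_fun_in_laurent eps
      del: of_nat_Suc power_int_minus power_int_of_nat)

lemma lookup_fock_act_Kinv_power:
  "Poly_Mapping.lookup (fock_act (uq_Kinv ^ n) v) (a, b) =
    (\<epsilon> powi (int (Suc (a + b)))) ^ n * Poly_Mapping.lookup v (a, b)"
  by (simp add: lookup_fock_act Ures_int_power Ures_int.Kinv rep_Kinv_power value_at_mult[OF eps] laurent_power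
      laurent_qvar_powi value_at_power value_at_qvar_powi[OF eps] lift_fun_value lift_fun_in_laurent eps
      del: of_nat_Suc power_int_minus power_int_of_nat)

text \<open>The coordinate of \<open>uq_Kbin t\<close> applied to a constant function, and therefore integral.\<close>

lemma qbinom_neg_laurent: "qbinom (- int (Suc n)) (int t) \<in> laurent"
proof -
  have "range (\<lambda>k::nat \<times> nat. 1 :: ratfun) \<subseteq> laurent"
    using laurent_1 by auto
  then have "rep (uq_Kbin t) (\<lambda>k. 1) (n, 0) \<in> laurent"
    by (rule specializable_laurent[OF specializable_rep[OF Ures_int_uq_Kbin]])
  then show ?thesis
    by (simp add: rep_uq_Kbin)
qed

lemma lookup_fock_act_Kbin:
  "Poly_Mapping.lookup (fock_act (uq_Kbin t) v) (a, b) =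
    qbinom_at \<epsilon> (- int (Suc (a + b))) (int t) * Poly_Mapping.lookup v (a, b)"
  by (simp add: lookup_fock_act Ures_int_uq_Kbin rep_uq_Kbin value_at_mult[OF eps] qbinom_neg_laurent
      lift_fun_value lift_fun_in_laurent del: of_nat_Suc)

lemma fock_act_scale:
  assumes "x \<in> Ures_int"
  shows "fock_act x (fock_scale c v) = fock_scale c (fock_act x v)"
proof -
  have "fock_scale c w = fock_act (uq_scal (ratconst c)) w" for w
    by (simp add: fock_act_scal laurent_ratconst eps)
  then show ?thesis
    using assms by (simp add: fock_act_times[symmetric] Ures_int.scal laurent_ratconst uq_scal_central)
qed

end


section \<open>The restricted Fock module\<close>

lemma fock_module_of_simps [simp]:
  "carrier (fock_module_of act) = UNIV" "\<zero>\<^bsub>fock_module_of act\<^esub> = 0"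
  "x \<oplus>\<^bsub>fock_module_of act\<^esub> y = x + y" "c \<odot>\<^bsub>fock_module_of act\<^esub> x = act c x"
  by (simp_all add: fock_module_of_def)

lemma fock_expand:
  "v = (\<Sum>k\<in>Poly_Mapping.keys v. fock_scale (Poly_Mapping.lookup v k) (Poly_Mapping.single k 1))"
proof (rule poly_mapping_eqI)
  fix k
  have "(\<Sum>j\<in>Poly_Mapping.keys v. Poly_Mapping.lookup v j * (1 when j = k)) =
      (\<Sum>j\<in>Poly_Mapping.keys v. if j = k then Poly_Mapping.lookup v k else 0)"
    by (intro sum.cong) (auto simp: when_def)
  then show "Poly_Mapping.lookup v k = Poly_Mapping.lookup
      (\<Sum>k\<in>Poly_Mapping.keys v. fock_scale (Poly_Mapping.lookup v k) (Poly_Mapping.single k 1)) k"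
    by (simp add: lookup_sum lookup_fock_scale lookup_single in_keys_iff)
qed

lemma fock_linear_eqI:
  assumes S: "\<And>v w. S (v + w) = S v + S w" "\<And>c v. S (fock_scale c v) = fock_scale c (S v)"
    and T: "\<And>v w. T (v + w) = T v + T w" "\<And>c v. T (fock_scale c v) = fock_scale c (T v)"
    and eq: "\<And>a b. S (Poly_Mapping.single (a, b) 1) = T (Poly_Mapping.single (a, b) 1)"
  shows "S v = (T v :: fock_space)"
proof -
  interpret S: Vector_Spaces.linear fock_scale fock_scale S by unfold_locales (simp_all add: S)
  interpret T: Vector_Spaces.linear fock_scale fock_scale T by unfold_locales (simp_all add: T)
  let ?c = "Poly_Mapping.lookup v" and ?e = "\<lambda>k. Poly_Mapping.single k (1 :: complex)"
  have eq': "S (?e k) = T (?e k)" for k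
    by (cases k) (simp only: eq)
  have "S v = S (\<Sum>k\<in>Poly_Mapping.keys v. fock_scale (?c k) (?e k))"
    by (rule arg_cong[OF fock_expand])
  also have "\<dots> = (\<Sum>k\<in>Poly_Mapping.keys v. fock_scale (?c k) (S (?e k)))"
    by (simp only: S.sum S)
  also have "\<dots> = (\<Sum>k\<in>Poly_Mapping.keys v. fock_scale (?c k) (T (?e k)))"
    by (simp only: eq')
  also have "\<dots> = T (\<Sum>k\<in>Poly_Mapping.keys v. fock_scale (?c k) (?e k))"
    by (simp only: T.sum T)
  also have "\<dots> = T v"
    by (rule arg_cong[OF fock_expand[symmetric]])
  finally show ?thesis .
qed

lemma fock_g_nat: "fock_g (int a) (int b) = Poly_Mapping.single (a, b) 1"
  by (simp add: fock_g_def)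

definition fock_rep :: "complex \<Rightarrow> uq set \<Rightarrow> fock_space \<Rightarrow> fock_space" where
  "fock_rep \<epsilon> X v = fock_act \<epsilon> (SOME u. u \<in> Ures_int \<and> spec \<epsilon> u = X) v"

context
  fixes \<epsilon> :: complex
  assumes eps: "\<epsilon> \<noteq> 0"
begin

lemma fock_rep_spec:
  assumes "u \<in> Ures_int"
  shows "fock_rep \<epsilon> (spec \<epsilon> u) v = fock_act \<epsilon> u v"
proof -
  let ?u = "SOME u'. u' \<in> Ures_int \<and> spec \<epsilon> u' = spec \<epsilon> u"
  have "?u \<in> Ures_int \<and> spec \<epsilon> ?u = spec \<epsilon> u"
    by (rule someI[of _ u]) (simp add: assms)
  then show ?thesis
    unfolding fock_rep_def using fock_act_spec_cong[OF eps] assms by metis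
qed

lemma fock_act_K_single:
  "fock_act \<epsilon> uq_K (Poly_Mapping.single (a, b) 1) =
     fock_scale (\<epsilon> powi (- int (Suc (a + b)))) (Poly_Mapping.single (a, b) 1)"
  using lookup_fock_act_K_power[OF eps, of 1]
  by (intro poly_mapping_eqI) (auto simp: lookup_fock_scale lookup_single when_def
      simp del: of_nat_Suc power_int_of_nat power_int_minus split: if_splits)

lemma fock_act_Kinv_single:
  "fock_act \<epsilon> uq_Kinv (Poly_Mapping.single (a, b) 1) =
     fock_scale (\<epsilon> powi (int (Suc (a + b)))) (Poly_Mapping.single (a, b) 1)"
  using lookup_fock_act_Kinv_power[OF eps, of 1]
  by (intro poly_mapping_eqI) (auto simp: lookup_fock_scale lookup_single when_def
      simp del: of_nat_Suc power_int_of_nat power_int_minus split: if_splits)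

lemma fock_act_Kbin_single:
  "fock_act \<epsilon> (uq_Kbin t) (Poly_Mapping.single (a, b) 1) =
     fock_scale (qbinom_at \<epsilon> (- int (Suc (a + b))) (int t)) (Poly_Mapping.single (a, b) 1)"
  by (rule poly_mapping_eqI)
    (auto simp: lookup_fock_act_Kbin[OF eps] lookup_fock_scale lookup_single when_def
      simp del: of_nat_Suc power_int_of_nat power_int_minus split: if_splits)

lemma fock_act_e_dp_single:
  "fock_act \<epsilon> (uq_e_dp r) (Poly_Mapping.single (a, b) 1) =
     (if r \<le> a \<and> r \<le> b then fock_scale (gbin \<epsilon> b r) (Poly_Mapping.single (a - r, b - r) 1) else 0)"
  by (rule poly_mapping_eqI)
    (auto simp: lookup_fock_act_e_dp[OF eps] lookup_fock_scale lookup_single when_def split: if_splits)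

lemma fock_act_f_dp_single:
  "fock_act \<epsilon> (uq_f_dp r) (Poly_Mapping.single (a, b) 1) =
     fock_scale ((- 1) ^ r * gbin \<epsilon> (a + r) r) (Poly_Mapping.single (a + r, b + r) 1)"
  by (rule poly_mapping_eqI)
    (auto simp: lookup_fock_act_f_dp[OF eps] lookup_fock_scale lookup_single when_def split: if_splits)

lemma fock_act_basis:
  shows "fock_act \<epsilon> uq_K (fock_g (int a) (int b)) =
      fock_scale (\<epsilon> powi (- (int a + int b + 1))) (fock_g (int a) (int b))"
    and "fock_act \<epsilon> uq_Kinv (fock_g (int a) (int b)) =
      fock_scale (\<epsilon> powi (int a + int b + 1)) (fock_g (int a) (int b))"
    and "fock_act \<epsilon> (uq_e_dp r) (fock_g (int a) (int b)) =
      fock_scale (qbinom_at \<epsilon> (int b) (int b - int r)) (fock_g (int a - int r) (int b - int r))"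
    and "fock_act \<epsilon> (uq_f_dp r) (fock_g (int a) (int b)) =
      fock_scale ((- 1) ^ r * qbinom_at \<epsilon> (int r + int a) (int r)) (fock_g (int a + int r) (int b + int r))"
proof -
  have n: "int a + int b + 1 = int (Suc (a + b))" by simp
  show "fock_act \<epsilon> uq_K (fock_g (int a) (int b)) =
      fock_scale (\<epsilon> powi (- (int a + int b + 1))) (fock_g (int a) (int b))"
    unfolding n fock_g_nat by (rule fock_act_K_single)
  show "fock_act \<epsilon> uq_Kinv (fock_g (int a) (int b)) =
      fock_scale (\<epsilon> powi (int a + int b + 1)) (fock_g (int a) (int b))"
    unfolding n fock_g_nat by (rule fock_act_Kinv_single)
  show "fock_act \<epsilon> (uq_e_dp r) (fock_g (int a) (int b)) =
      fock_scale (qbinom_at \<epsilon> (int b) (int b - int r)) (fock_g (int a - int r) (int b - int r))"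
  proof (cases "r \<le> a \<and> r \<le> b")
    case True
    \<comment> \<open>Symmetry is proved for generic \<open>q\<close>, where no \<open>[k]\<close> vanishes, and then specialized.\<close>
    have "gbin qvar b (b - r) = gbin qvar b r"
      using True by (intro gbin_symmetric) auto
    then have "gbin \<epsilon> b (b - r) = gbin \<epsilon> b r"
      by (metis value_at_gbin[OF eps])
    moreover have "int a - int r = int (a - r)" "int b - int r = int (b - r)"
      using True by auto
    ultimately show ?thesis
      using True by (simp only: fock_g_nat fock_act_e_dp_single qbinom_eq_gbin value_at_gbin[OF eps] if_True simp_thms)
  next
    case False
    then have "fock_g (int a - int r) (int b - int r) = 0"
      by (auto simp: fock_g_def)
    then show ?thesis
      unfolding fock_g_nat fock_act_e_dp_single if_not_P[OF False] by simp
  qed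
  have "int r + int a = int (a + r)" "int a + int r = int (a + r)" "int b + int r = int (b + r)"
    by auto
  then show "fock_act \<epsilon> (uq_f_dp r) (fock_g (int a) (int b)) =
      fock_scale ((- 1) ^ r * qbinom_at \<epsilon> (int r + int a) (int r)) (fock_g (int a + int r) (int b + int r))"
    by (simp only: fock_g_nat fock_act_f_dp_single qbinom_eq_gbin value_at_gbin[OF eps])
qed

lemma fock_rep_action: "is_fock_action \<epsilon> (fock_rep \<epsilon>)"
  unfolding is_fock_action_def
proof (intro conjI allI impI)
  let ?M = "fock_module_of (fock_rep \<epsilon>)"
  have "abelian_group ?M"
    by (rule abelian_groupI) (auto simp: add_ac intro: exI[of _ "- x" for x])
  moreover have "left_module_axioms (Ures \<epsilon>) ?M"
    by (rule left_module_axioms.intro)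
      (auto simp: carrier_Ures spec_add spec_mult spec_one fock_rep_spec Ures_int.plus Ures_int.times
        Ures_int_1 fock_act_plus[OF eps] fock_act_times[OF eps] fock_act_add[OF eps] fock_act_one[OF eps])
  ultimately show "left_module (Ures \<epsilon>) ?M"
    by (intro left_module.intro ring_Ures)
  show "fock_rep \<epsilon> (spec_scal \<epsilon> c) v = fock_scale c v" for c v
    by (simp add: spec_scal_def fock_rep_spec Ures_int.scal laurent_ratconst fock_act_scal[OF eps] eps)
  fix r1 r2 :: int assume "0 \<le> r1" "0 \<le> r2"
  then obtain a b where [simp]: "r1 = int a" "r2 = int b"
    by (metis nonneg_int_cases)
  show "fock_rep \<epsilon> (spec \<epsilon> uq_K) (fock_g r1 r2) = fock_scale (\<epsilon> powi (- (r1 + r2 + 1))) (fock_g r1 r2)"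
    "fock_rep \<epsilon> (spec \<epsilon> uq_Kinv) (fock_g r1 r2) = fock_scale (\<epsilon> powi (r1 + r2 + 1)) (fock_g r1 r2)"
    "fock_rep \<epsilon> (spec \<epsilon> (uq_e_dp r)) (fock_g r1 r2) =
          fock_scale (qbinom_at \<epsilon> r2 (r2 - int r)) (fock_g (r1 - int r) (r2 - int r))"
    "fock_rep \<epsilon> (spec \<epsilon> (uq_f_dp r)) (fock_g r1 r2) =
          fock_scale ((- 1) ^ r * qbinom_at \<epsilon> (int r + r1) (int r)) (fock_g (r1 + int r) (r2 + int r))" for r
    by (simp_all only: fock_rep_spec Ures_int.K Ures_int.Kinv Ures_int_dp fock_act_basis \<open>r1 = int a\<close> \<open>r2 = int b\<close>)
qed

text \<open>Both sides respect sums, products and scalars, and on the remaining generators they are linear in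
  \<open>v\<close> and prescribed on basis vectors.\<close>

lemma fock_action_unique:
  assumes act: "is_fock_action \<epsilon> act" and u: "u \<in> Ures_int"
  shows "act (spec \<epsilon> u) v = fock_act \<epsilon> u v"
proof -
  interpret left_module "Ures \<epsilon>" "fock_module_of act"
    using act by (simp add: is_fock_action_def)
  have scal: "act (spec_scal \<epsilon> c) v = fock_scale c v" for c v
    using act by (simp add: is_fock_action_def)
  have add: "act (spec \<epsilon> x) (v + w) = act (spec \<epsilon> x) v + act (spec \<epsilon> x) w" if "x \<in> Ures_int" for x v w
    using smult_r_distr[of "spec \<epsilon> x" v w] that by (simp add: spec_closed)
  have mult: "act (spec \<epsilon> (x * y)) v = act (spec \<epsilon> x) (act (spec \<epsilon> y) v)"
    if "x \<in> Ures_int" "y \<in> Ures_int" for x y v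
    using smult_assoc[of "spec \<epsilon> x" "spec \<epsilon> y" v] that by (simp add: spec_closed spec_mult)
  have scale: "act (spec \<epsilon> x) (fock_scale c v) = fock_scale c (act (spec \<epsilon> x) v)" if "x \<in> Ures_int" for x c v
    unfolding scal[symmetric] unfolding spec_scal_def
    by (simp add: mult[symmetric] that Ures_int.scal laurent_ratconst uq_scal_central)
  have eqI: "act (spec \<epsilon> x) v = fock_act \<epsilon> x v" if "x \<in> Ures_int"
    "\<And>a b. act (spec \<epsilon> x) (fock_g (int a) (int b)) = fock_act \<epsilon> x (fock_g (int a) (int b))" for x v
    by (rule fock_linear_eqI[of "act (spec \<epsilon> x)" "fock_act \<epsilon> x"])
      (simp_all add: add scale fock_act_add[OF eps] fock_act_scale[OF eps] that(1) that(2)[unfolded fock_g_nat])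
  from u show ?thesis
  proof (induction arbitrary: v)
    case (scal a)
    then show ?case
      using \<open>\<And>c v. act (spec_scal \<epsilon> c) v = fock_scale c v\<close>
      by (simp add: spec_laurent[OF eps] fock_act_scal[OF eps])
  next
    case K
    show ?case
      by (rule eqI[OF Ures_int.K]) (use act in \<open>simp add: is_fock_action_def fock_act_basis\<close>)
  next
    case Kinv
    show ?case
      by (rule eqI[OF Ures_int.Kinv]) (use act in \<open>simp add: is_fock_action_def fock_act_basis\<close>)
  next
    case (e_dp r)
    show ?case
      by (rule eqI[OF Ures_int.e_dp[OF e_dp]]) (use act e_dp in \<open>simp add: is_fock_action_def fock_act_basis\<close>)
  next
    case (f_dp r)
    show ?case
      by (rule eqI[OF Ures_int.f_dp[OF f_dp]]) (use act f_dp in \<open>simp add: is_fock_action_def fock_act_basis\<close>)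
  next
    case (plus x y)
    then show ?case
      using smult_l_distr[of "spec \<epsilon> x" "spec \<epsilon> y" v]
      by (simp add: spec_closed spec_add fock_act_plus[OF eps])
  next
    case (times x y)
    then show ?case
      by (simp add: mult fock_act_times[OF eps])
  qed
qed

lemma fock_module_action: "is_fock_action \<epsilon> (SOME act. is_fock_action \<epsilon> act)"
  by (rule someI[of "is_fock_action \<epsilon>", OF fock_rep_action])

lemma left_module_fock: "left_module (Ures \<epsilon>) (fock_module \<epsilon>)"
  using fock_module_action unfolding fock_module_def by (rule is_fock_action_def[THEN iffD1, THEN conjunct1])

lemma fock_module_smult: "u \<in> Ures_int \<Longrightarrow> spec \<epsilon> u \<odot>\<^bsub>fock_module \<epsilon>\<^esub> v = fock_act \<epsilon> u v"
  unfolding fock_module_def fock_module_of_simps by (rule fock_action_unique[OF fock_module_action])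

end

lemma fock_module_simps [simp]:
  "carrier (fock_module \<epsilon>) = UNIV" "\<zero>\<^bsub>fock_module \<epsilon>\<^esub> = 0" "x \<oplus>\<^bsub>fock_module \<epsilon>\<^esub> y = x + y"
  by (simp_all add: fock_module_def)


section \<open>Submodules and quotients\<close>

context left_module
begin

lemma smult_zero_left: "x \<in> carrier M \<Longrightarrow> \<zero> \<odot>\<^bsub>M\<^esub> x = \<zero>\<^bsub>M\<^esub>"
proof -
  assume x: "x \<in> carrier M"
  have "\<zero> \<odot>\<^bsub>M\<^esub> x \<oplus>\<^bsub>M\<^esub> \<zero> \<odot>\<^bsub>M\<^esub> x = \<zero> \<odot>\<^bsub>M\<^esub> x \<oplus>\<^bsub>M\<^esub> \<zero>\<^bsub>M\<^esub>"
    using x smult_l_distr[of \<zero> \<zero> x] by (simp add: smult_closed)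
  then show ?thesis
    using x by (simp add: smult_closed)
qed

lemma smult_minus_one: "x \<in> carrier M \<Longrightarrow> (\<ominus> \<one>) \<odot>\<^bsub>M\<^esub> x = \<ominus>\<^bsub>M\<^esub> x"
proof -
  assume x: "x \<in> carrier M"
  have "(\<ominus> \<one>) \<odot>\<^bsub>M\<^esub> x \<oplus>\<^bsub>M\<^esub> x = \<zero>\<^bsub>M\<^esub>"
    using x smult_l_distr[of "\<ominus> \<one>" \<one> x] by (simp add: smult_one smult_zero_left R.l_neg)
  then show ?thesis
    using x M.minus_equality by (simp add: smult_closed)
qed

text \<open>Negatives are multiples by the scalar \<open>-1\<close> of the ring.\<close>

lemma submodule_iff:
  "submodule N R M \<longleftrightarrow> N \<subseteq> carrier M \<and> \<zero>\<^bsub>M\<^esub> \<in> N \<and> (\<forall>x\<in>N. \<forall>y\<in>N. x \<oplus>\<^bsub>M\<^esub> y \<in> N) \<and>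
     (\<forall>a\<in>carrier R. \<forall>x\<in>N. a \<odot>\<^bsub>M\<^esub> x \<in> N)"
proof
  assume "submodule N R M"
  then interpret submodule N R M .
  show "N \<subseteq> carrier M \<and> \<zero>\<^bsub>M\<^esub> \<in> N \<and> (\<forall>x\<in>N. \<forall>y\<in>N. x \<oplus>\<^bsub>M\<^esub> y \<in> N) \<and>
     (\<forall>a\<in>carrier R. \<forall>x\<in>N. a \<odot>\<^bsub>M\<^esub> x \<in> N)"
    using subset m_closed one_closed by auto
next
  assume N: "N \<subseteq> carrier M \<and> \<zero>\<^bsub>M\<^esub> \<in> N \<and> (\<forall>x\<in>N. \<forall>y\<in>N. x \<oplus>\<^bsub>M\<^esub> y \<in> N) \<and>
     (\<forall>a\<in>carrier R. \<forall>x\<in>N. a \<odot>\<^bsub>M\<^esub> x \<in> N)"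
  show "submodule N R M"
  proof (intro submodule.intro submodule_axioms.intro M.add.subgroupI)
    fix x assume "x \<in> N"
    then show "\<ominus>\<^bsub>M\<^esub> x \<in> N"
      using N smult_minus_one[of x] by (metis R.add.inv_closed R.one_closed subsetD)
  qed (use N in auto)
qed

end

lemma left_module_restrict:
  fixes R (structure) and M :: "('r, 'm) module"
  assumes "left_module R M" and "submodule N R M"
  shows "left_module R (restrict_module M N)"
proof -
  interpret left_module R M by (rule assms)
  show ?thesis
  proof (intro left_module.intro left_module_axioms.intro R.ring_axioms)
    note N = assms(2)[unfolded submodule_iff]
    show "abelian_group (restrict_module M N)"
    proof (rule abelian_groupI)
      fix x assume "x \<in> carrier (restrict_module M N)"
      then have "x \<in> N" by (simp add: restrict_module_def)
      then have "\<ominus>\<^bsub>M\<^esub> x \<in> N" "\<ominus>\<^bsub>M\<^esub> x \<oplus>\<^bsub>M\<^esub> x = \<zero>\<^bsub>M\<^esub>"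
        using N smult_minus_one[of x] M.l_neg by (metis R.add.inv_closed R.one_closed subsetD, blast)
      then show "\<exists>y\<in>carrier (restrict_module M N). y \<oplus>\<^bsub>restrict_module M N\<^esub> x = \<zero>\<^bsub>restrict_module M N\<^esub>"
        by (auto simp: restrict_module_def)
    qed (use N in \<open>auto simp: restrict_module_def M.add.m_assoc M.add.m_comm M.add.m_lcomm subset_iff\<close>)
  qed (use assms(2)[unfolded submodule_iff] in
    \<open>auto simp: restrict_module_def smult_l_distr smult_r_distr smult_assoc smult_one subset_iff\<close>)
qed

lemma (in left_module) submodule_abelian_subgroup:
  assumes "submodule N R M"
  shows "abelian_subgroup N M"
  using assms M.abelian_group_axioms
  by (intro abelian_subgroupI3 additive_subgroup.intro) (auto simp: submodule_def)

text \<open>Scalar multiplication of a coset is a union over its elements; all sets in this union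
  coincide.\<close>

lemma quotient_module_simps:
  fixes R (structure) and M :: "('r, 'm) module"
  assumes "left_module R M" and "submodule N R M"
  shows "carrier (quotient_module M N) = (\<lambda>x. N +>\<^bsub>M\<^esub> x) ` carrier M"
    and "\<zero>\<^bsub>quotient_module M N\<^esub> = N"
    and "x \<in> carrier M \<Longrightarrow> y \<in> carrier M \<Longrightarrow>
      (N +>\<^bsub>M\<^esub> x) \<oplus>\<^bsub>quotient_module M N\<^esub> (N +>\<^bsub>M\<^esub> y) = N +>\<^bsub>M\<^esub> (x \<oplus>\<^bsub>M\<^esub> y)"
    and "a \<in> carrier R \<Longrightarrow> x \<in> carrier M \<Longrightarrow>
      a \<odot>\<^bsub>quotient_module M N\<^esub> (N +>\<^bsub>M\<^esub> x) = N +>\<^bsub>M\<^esub> (a \<odot>\<^bsub>M\<^esub> x)"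
    and "x \<in> carrier M \<Longrightarrow> N +>\<^bsub>M\<^esub> x = N \<longleftrightarrow> x \<in> N"
proof -
  interpret left_module R M by (rule assms)
  interpret N: abelian_subgroup N M
    by (rule submodule_abelian_subgroup[OF assms(2)])
  note sub = assms(2)[unfolded submodule_iff]
  have N': "subgroup N (add_monoid M)"
    using N.a_subgroup .
  show "carrier (quotient_module M N) = (\<lambda>x. N +>\<^bsub>M\<^esub> x) ` carrier M"
    by (auto simp: quotient_module_def A_RCOSETS_def')
  show "\<zero>\<^bsub>quotient_module M N\<^esub> = N"
    by (simp add: quotient_module_def)
  show "(N +>\<^bsub>M\<^esub> x) \<oplus>\<^bsub>quotient_module M N\<^esub> (N +>\<^bsub>M\<^esub> y) = N +>\<^bsub>M\<^esub> (x \<oplus>\<^bsub>M\<^esub> y)"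
    if "x \<in> carrier M" "y \<in> carrier M"
    using N.a_rcos_sum[OF that] by (simp add: quotient_module_def)
  show "N +>\<^bsub>M\<^esub> x = N \<longleftrightarrow> x \<in> N" if "x \<in> carrier M"
    using M.a_coset_join1[OF _ that N'] M.a_coset_join2[OF that N'] by blast
  show "a \<odot>\<^bsub>quotient_module M N\<^esub> (N +>\<^bsub>M\<^esub> x) = N +>\<^bsub>M\<^esub> (a \<odot>\<^bsub>M\<^esub> x)"
    if a: "a \<in> carrier R" and x: "x \<in> carrier M"
  proof -
    have "N +>\<^bsub>M\<^esub> (a \<odot>\<^bsub>M\<^esub> y) = N +>\<^bsub>M\<^esub> (a \<odot>\<^bsub>M\<^esub> x)" if y: "y \<in> N +>\<^bsub>M\<^esub> x" for y
    proof -
      obtain h where h: "h \<in> N" "y = h \<oplus>\<^bsub>M\<^esub> x"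
        using y by (auto simp: a_r_coset_def r_coset_def)
      then have "a \<odot>\<^bsub>M\<^esub> y = a \<odot>\<^bsub>M\<^esub> h \<oplus>\<^bsub>M\<^esub> a \<odot>\<^bsub>M\<^esub> x" "a \<odot>\<^bsub>M\<^esub> h \<in> N"
        using a x sub by (auto simp: smult_r_distr subset_iff)
      then have "a \<odot>\<^bsub>M\<^esub> y \<in> N +>\<^bsub>M\<^esub> (a \<odot>\<^bsub>M\<^esub> x)"
        by (auto simp: a_r_coset_def r_coset_def)
      then show ?thesis
        using M.a_repr_independence[OF _ _ N'] a x by (simp add: smult_closed)
    qed
    moreover have "x \<in> N +>\<^bsub>M\<^esub> x"
      using x by (rule N.a_rcos_self)
    ultimately have "(\<Union>y\<in>N +>\<^bsub>M\<^esub> x. N +>\<^bsub>M\<^esub> (a \<odot>\<^bsub>M\<^esub> y)) = N +>\<^bsub>M\<^esub> (a \<odot>\<^bsub>M\<^esub> x)"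
      by (intro UN_constant_eq ballI)
    then show ?thesis
      by (simp only: quotient_module_def module.simps)
  qed
qed

lemma left_module_quotient:
  fixes R (structure) and M :: "('r, 'm) module"
  assumes "left_module R M" and "submodule N R M"
  shows "left_module R (quotient_module M N)"
proof -
  interpret left_module R M by (rule assms)
  interpret N: abelian_subgroup N M
    by (rule submodule_abelian_subgroup[OF assms(2)])
  note [simp] = quotient_module_simps[OF assms]
  show ?thesis
  proof (intro left_module.intro R.ring_axioms)
    let ?Q = "quotient_module M N"
    have "\<zero>\<^bsub>M\<^esub> \<in> N"
      using assms(2) by (simp add: submodule_iff)
    then have "N +>\<^bsub>M\<^esub> \<zero>\<^bsub>M\<^esub> = N"
      using quotient_module_simps(5)[OF assms, of "\<zero>\<^bsub>M\<^esub>"] by blast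
    then have zero: "\<zero>\<^bsub>?Q\<^esub> = N +>\<^bsub>M\<^esub> \<zero>\<^bsub>M\<^esub>"
      by (simp only: quotient_module_simps(2)[OF assms])
    show "abelian_group ?Q"
    proof (rule abelian_groupI)
      fix X assume "X \<in> carrier ?Q"
      then obtain x where x: "x \<in> carrier M" "X = N +>\<^bsub>M\<^esub> x" by auto
      then have "(N +>\<^bsub>M\<^esub> (\<ominus>\<^bsub>M\<^esub> x)) \<oplus>\<^bsub>?Q\<^esub> X = \<zero>\<^bsub>?Q\<^esub>"
        unfolding zero by (simp add: M.l_neg)
      then show "\<exists>Y\<in>carrier ?Q. Y \<oplus>\<^bsub>?Q\<^esub> X = \<zero>\<^bsub>?Q\<^esub>"
        using x by auto
      show "\<zero>\<^bsub>?Q\<^esub> \<oplus>\<^bsub>?Q\<^esub> X = X"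
        unfolding zero using x by simp
    next
      show "\<zero>\<^bsub>?Q\<^esub> \<in> carrier ?Q"
        unfolding zero by auto
    qed (auto simp: M.add.m_assoc M.add.m_comm M.add.m_lcomm)
    show "left_module_axioms R (quotient_module M N)"
      by (rule left_module_axioms.intro)
        (auto simp: smult_closed smult_l_distr smult_r_distr smult_assoc smult_one)
  qed
qed

lemma module_iso_refl: "left_module R M \<Longrightarrow> module_iso R M M"
  unfolding module_iso_def by (intro conjI exI[of _ "\<lambda>x. x"]) (auto simp: bij_betw_def)


section \<open>Subquotients on a line of basis vectors\<close>

definition fock_line :: "nat \<Rightarrow> nat set \<Rightarrow> fock_space set" where
  "fock_line a A = {v. Poly_Mapping.keys v \<subseteq> (\<lambda>m. (m + a, m)) ` A}"

text \<open>No nonzero coefficient of a divided power of \<open>e\<close> or \<open>f\<close> leads out of the set of indices.\<close>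

definition line_stable :: "complex \<Rightarrow> nat \<Rightarrow> nat set \<Rightarrow> bool" where
  "line_stable \<epsilon> a A \<longleftrightarrow> (\<forall>m\<in>A. \<forall>r.
     (r \<le> m \<and> m - r \<notin> A \<longrightarrow> gbin \<epsilon> m r = 0) \<and> (m + r \<notin> A \<longrightarrow> gbin \<epsilon> (m + r + a) r = 0))"

abbreviation line_vec :: "nat \<Rightarrow> nat \<Rightarrow> fock_space" where
  "line_vec a m \<equiv> Poly_Mapping.single (m + a, m) 1"

lemma fock_line_iff:
  "v \<in> fock_line a A \<longleftrightarrow> (\<forall>x y. Poly_Mapping.lookup v (x, y) \<noteq> 0 \<longrightarrow> x = y + a \<and> y \<in> A)"
  by (auto simp: fock_line_def in_keys_iff[symmetric] subset_iff image_iff)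

lemma fock_line_zero: "0 \<in> fock_line a A"
  by (simp add: fock_line_iff)

lemma fock_line_add: "v \<in> fock_line a A \<Longrightarrow> w \<in> fock_line a A \<Longrightarrow> v + w \<in> fock_line a A"
  unfolding fock_line_iff lookup_add by (metis add.left_neutral)

lemma fock_line_scale: "v \<in> fock_line a A \<Longrightarrow> fock_scale c v \<in> fock_line a A"
  unfolding fock_line_iff lookup_fock_scale by (metis mult_zero_right)

lemma fock_line_sum: "(\<And>i. i \<in> I \<Longrightarrow> g i \<in> fock_line a A) \<Longrightarrow> sum g I \<in> fock_line a A"
  by (induction I rule: infinite_finite_induct) (auto intro: fock_line_zero fock_line_add)

lemma line_vec_in: "line_vec a m \<in> fock_line a A \<longleftrightarrow> m \<in> A"
  by (auto simp: fock_line_def)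

lemma fock_line_mono: "A \<subseteq> B \<Longrightarrow> fock_line a A \<subseteq> fock_line a B"
  unfolding fock_line_def by blast

lemma lookup_line_vec:
  "Poly_Mapping.lookup (line_vec a m) (x, y) = (if x = y + a \<and> y = m then 1 else 0)"
  by (auto simp: lookup_single when_def)

lemma fock_line_expand:
  assumes "v \<in> fock_line a A"
  obtains T where "finite T" "T \<subseteq> A" "\<And>m. m \<in> T \<longleftrightarrow> Poly_Mapping.lookup v (m + a, m) \<noteq> 0"
    "v = (\<Sum>m\<in>T. fock_scale (Poly_Mapping.lookup v (m + a, m)) (line_vec a m))"
proof
  let ?T = "{m. Poly_Mapping.lookup v (m + a, m) \<noteq> 0}" and ?i = "\<lambda>m. (m + a, m)"
  have keys: "Poly_Mapping.keys v = ?i ` ?T"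
  proof
    show "Poly_Mapping.keys v \<subseteq> ?i ` ?T"
      using assms unfolding fock_line_def in_keys_iff[symmetric] by blast
  qed (auto simp: in_keys_iff)
  have inj: "inj_on ?i B" for B
    by (rule inj_onI) simp
  show "finite ?T"
    using finite_keys[of v] unfolding keys by (simp add: finite_image_iff[OF inj])
  show "?T \<subseteq> A"
    using assms by (auto simp: fock_line_iff)
  show "v = (\<Sum>m\<in>?T. fock_scale (Poly_Mapping.lookup v (m + a, m)) (line_vec a m))"
    by (subst fock_expand[of v], unfold keys sum.reindex[OF inj]) simp
qed simp

lemma fock_span_line: "fock_span (line_vec a ` A) = fock_line a A"
proof
  have "fock.subspace (fock_line a A)"
    by (auto simp: fock.subspace_def fock_line_zero fock_line_add fock_line_scale)
  then show "fock_span (line_vec a ` A) \<subseteq> fock_line a A"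
    by (intro fock.span_minimal) (auto simp: line_vec_in)
  show "fock_line a A \<subseteq> fock_span (line_vec a ` A)"
  proof
    fix v assume v: "v \<in> fock_line a A"
    then obtain T where T: "finite T" "T \<subseteq> A" "v = (\<Sum>m\<in>T. fock_scale (Poly_Mapping.lookup v (m + a, m)) (line_vec a m))"
      by (rule fock_line_expand)
    have "(\<Sum>m\<in>T. fock_scale (Poly_Mapping.lookup v (m + a, m)) (line_vec a m)) \<in> fock_span (line_vec a ` A)"
      using T(2) by (intro fock.span_sum fock.span_scale fock.span_base) auto
    with T(3) show "v \<in> fock_span (line_vec a ` A)"
      by simp
  qed
qed

lemma fock_line_act:
  assumes eps: "\<epsilon> \<noteq> 0" and st: "line_stable \<epsilon> a A" and "u \<in> Ures_int" and "v \<in> fock_line a A"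
  shows "fock_act \<epsilon> u v \<in> fock_line a A"
  using assms(3,4)
proof (induction arbitrary: v)
  case (scal c)
  then show ?case by (simp add: fock_act_scal[OF eps] fock_line_scale)
next
  case K
  then show ?case
    using lookup_fock_act_K_power[OF eps, of 1] by (auto simp: fock_line_iff)
next
  case Kinv
  then show ?case
    using lookup_fock_act_Kinv_power[OF eps, of 1] by (auto simp: fock_line_iff)
next
  case (e_dp r)
  show ?case
    unfolding fock_line_iff lookup_fock_act_e_dp[OF eps]
  proof (intro allI impI)
    fix x y assume nz: "gbin \<epsilon> (y + r) r * Poly_Mapping.lookup v (x + r, y + r) \<noteq> 0"
    then have "x + r = y + r + a" "y + r \<in> A"
      using e_dp by (auto simp: fock_line_iff)
    moreover have "y \<in> A"
      using st nz \<open>y + r \<in> A\<close> unfolding line_stable_def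
      by (metis diff_add_inverse2 le_add2 mult_eq_0_iff)
    ultimately show "x = y + a \<and> y \<in> A" by simp
  qed
next
  case (f_dp r)
  show ?case
    unfolding fock_line_iff lookup_fock_act_f_dp[OF eps]
  proof (intro allI impI)
    fix x y assume nz: "(if r \<le> x \<and> r \<le> y
      then (- 1) ^ r * gbin \<epsilon> x r * Poly_Mapping.lookup v (x - r, y - r) else 0) \<noteq> 0"
    then have r: "r \<le> x" "r \<le> y" and nz': "gbin \<epsilon> x r \<noteq> 0" "Poly_Mapping.lookup v (x - r, y - r) \<noteq> 0"
      by (auto split: if_splits)
    then have *: "x - r = y - r + a" "y - r \<in> A"
      using f_dp by (auto simp: fock_line_iff)
    then have x: "x = y + a" using r by linarith
    have "y \<in> A"
      using st *(2) nz'(1) r unfolding x line_stable_def by (metis le_add_diff_inverse2)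
    with x show "x = y + a \<and> y \<in> A" by simp
  qed
next
  case (plus x y)
  then show ?case by (simp add: fock_act_plus[OF eps] fock_line_add)
next
  case (times x y)
  then show ?case by (simp add: fock_act_times[OF eps])
qed

lemma uq_e_eq_dp: "uq_e = uq_e_dp 1"
  by (simp add: uq_e_dp_def qfact_def)

text \<open>The module \<open>V\<close> is the quotient of the submodule with indices \<open>A\<close> by the one with indices \<open>A'\<close>, in the
  form of a map \<open>\<pi>\<close> onto \<open>V\<close>, so that submodules and their quotients are covered alike. The last two
  assumptions say that the lowest index \<open>h\<close> can be reached from every index of \<open>V\<close> in one step, and
  conversely.\<close>

locale line_subquotient =
  fixes \<epsilon> :: complex and p a h :: nat and A A' :: "nat set"
    and V :: "(uq set, 'm) module" and \<pi> :: "fock_space \<Rightarrow> 'm"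
  assumes p: "p > 0" and root: "\<epsilon> ^ p = 1"
    and sub: "A' \<subseteq> A" and stable: "line_stable \<epsilon> a A" "line_stable \<epsilon> a A'"
    and V: "left_module (Ures \<epsilon>) V"
    and pi_add: "\<And>v w. v \<in> fock_line a A \<Longrightarrow> w \<in> fock_line a A \<Longrightarrow> \<pi> (v + w) = \<pi> v \<oplus>\<^bsub>V\<^esub> \<pi> w"
    and pi_act: "\<And>u v. u \<in> Ures_int \<Longrightarrow> v \<in> fock_line a A \<Longrightarrow> \<pi> (fock_act \<epsilon> u v) = spec \<epsilon> u \<odot>\<^bsub>V\<^esub> \<pi> v"
    and pi_surj: "carrier V = \<pi> ` fock_line a A"
    and pi_ker: "\<And>v. v \<in> fock_line a A \<Longrightarrow> \<pi> v = \<zero>\<^bsub>V\<^esub> \<longleftrightarrow> v \<in> fock_line a A'"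
    and h: "h \<in> A - A'" and h_least: "\<And>m. m \<in> A - A' \<Longrightarrow> h \<le> m"
    and down: "\<And>m. m \<in> A - A' \<Longrightarrow> gbin \<epsilon> m (m - h) \<noteq> 0"
    and up: "\<And>m. m \<in> A - A' \<Longrightarrow> gbin \<epsilon> (m + a) (m - h) \<noteq> 0"
begin

lemma eps: "\<epsilon> \<noteq> 0"
  using root p by (metis less_nat_zero_code power_0_left zero_neq_one)

sublocale V: left_module "Ures \<epsilon>" V
  by (rule V)

lemma scale_eq_act: "fock_scale c v = fock_act \<epsilon> (uq_scal (ratconst c)) v"
  by (simp add: fock_act_scal[OF eps] laurent_ratconst eps)

lemma pi_scale: "v \<in> fock_line a A \<Longrightarrow> \<pi> (fock_scale c v) = spec_scal \<epsilon> c \<odot>\<^bsub>V\<^esub> \<pi> v"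
  unfolding scale_eq_act spec_scal_def by (intro pi_act Ures_int.scal laurent_ratconst)

lemma act_line: "u \<in> Ures_int \<Longrightarrow> v \<in> fock_line a A \<Longrightarrow> fock_act \<epsilon> u v \<in> fock_line a A"
  by (rule fock_line_act[OF eps stable(1)])

lemma vec_h: "line_vec a h \<in> fock_line a A" "line_vec a h \<notin> fock_line a A'"
  using h by (auto simp: line_vec_in)

text \<open>The submodules of \<open>V\<close> are studied through their preimages, where coordinates are available.\<close>

definition pullback :: "'m set \<Rightarrow> fock_space set" where
  "pullback N = {v \<in> fock_line a A. \<pi> v \<in> N}"

context
  fixes N assumes N: "submodule N (Ures \<epsilon>) V"
begin

lemma pullback_add: "v \<in> pullback N \<Longrightarrow> w \<in> pullback N \<Longrightarrow> v + w \<in> pullback N"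
  using N by (auto simp: pullback_def V.submodule_iff fock_line_add pi_add)

lemma pullback_act: "u \<in> Ures_int \<Longrightarrow> v \<in> pullback N \<Longrightarrow> fock_act \<epsilon> u v \<in> pullback N"
  using N by (auto simp: pullback_def V.submodule_iff act_line pi_act spec_closed)

lemma pullback_scale: "v \<in> pullback N \<Longrightarrow> fock_scale c v \<in> pullback N"
  unfolding scale_eq_act by (intro pullback_act Ures_int.scal laurent_ratconst)

lemma pullback_scale_iff: "c \<noteq> 0 \<Longrightarrow> fock_scale c v \<in> pullback N \<longleftrightarrow> v \<in> pullback N"
  using pullback_scale[of "fock_scale c v" "inverse c"] pullback_scale[of v c] by auto

lemma pullback_kernel: "v \<in> fock_line a A' \<Longrightarrow> v \<in> pullback N"
  using N fock_line_mono[OF sub, of a] pi_ker[of v] by (auto simp: pullback_def V.submodule_iff)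

text \<open>Let \<open>M\<close> be the largest index outside \<open>A'\<close> at which \<open>v\<close> has a nonzero coordinate. Modulo \<open>A'\<close>,
  the divided power of \<open>e\<close> of order \<open>M - h\<close> leaves of \<open>v\<close> only the contribution of \<open>M\<close>: indices below
  \<open>M\<close> go below \<open>h\<close>, and those in \<open>A'\<close> stay in \<open>A'\<close>.\<close>

lemma pullback_lowest:
  assumes v: "v \<in> pullback N" "v \<notin> fock_line a A'"
  shows "line_vec a h \<in> pullback N"
proof -
  let ?c = "\<lambda>m. Poly_Mapping.lookup v (m + a, m)"
  have vA: "v \<in> fock_line a A"
    using v by (simp add: pullback_def)
  then obtain T where T: "finite T" "T \<subseteq> A" "\<And>m. m \<in> T \<longleftrightarrow> ?c m \<noteq> 0"
    by (rule fock_line_expand) (rule that)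
  define M where "M = Max (T - A')"
  have "T - A' \<noteq> {}"
    using v(2) vA T(3) by (fastforce simp: fock_line_iff)
  then have M: "M \<in> T - A'" "\<And>m. m \<in> T - A' \<Longrightarrow> m \<le> M"
    using T(1) unfolding M_def by (intro Max_in Max_ge; simp)+
  have hM: "h \<le> M"
    using M(1) T(2) by (intro h_least) auto
  let ?u = "uq_e_dp (M - h)" and ?b = "gbin \<epsilon> M (M - h) * ?c M"
  have b: "?b \<noteq> 0"
    using M(1) T down[of M] by auto
  have act: "fock_act \<epsilon> ?u v \<in> pullback N"
    by (intro pullback_act Ures_int_dp v)
  have "fock_act \<epsilon> ?u v + fock_scale (- ?b) (line_vec a h) \<in> fock_line a A'"
    unfolding fock_line_iff
  proof (intro allI impI)
    fix x y
    assume nz: "Poly_Mapping.lookup (fock_act \<epsilon> ?u v + fock_scale (- ?b) (line_vec a h)) (x, y) \<noteq> 0"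
    have eq: "Poly_Mapping.lookup (fock_act \<epsilon> ?u v + fock_scale (- ?b) (line_vec a h)) (x, y)
      = gbin \<epsilon> (y + (M - h)) (M - h) * Poly_Mapping.lookup v (x + (M - h), y + (M - h))
        - (if x = y + a \<and> y = h then ?b else 0)"
      unfolding lookup_add lookup_fock_scale lookup_line_vec lookup_fock_act_e_dp[OF eps] by simp
    have xy: "\<not> (x = y + a \<and> y = h)"
    proof
      assume xy: "x = y + a \<and> y = h"
      then have "y + (M - h) = M" "x + (M - h) = M + a"
        using hM by auto
      then show False
        using nz xy unfolding eq by (simp add: add.commute)
    qed
    then have nz': "gbin \<epsilon> (y + (M - h)) (M - h) \<noteq> 0" "Poly_Mapping.lookup v (x + (M - h), y + (M - h)) \<noteq> 0"
      using nz unfolding eq by auto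
    then have "x + (M - h) = y + (M - h) + a" and yA: "y + (M - h) \<in> A"
      using vA unfolding fock_line_iff by blast+
    then have x: "x = y + a"
      by simp
    have "y + (M - h) \<in> T"
      using nz'(2) by (simp add: T(3) x add_ac)
    have "y \<in> A"
      using stable(1) yA nz'(1) unfolding line_stable_def by (metis diff_add_inverse2 le_add2)
    moreover have "y \<in> A'" if "y + (M - h) \<in> A'"
      using stable(2) that nz'(1) unfolding line_stable_def by (metis diff_add_inverse2 le_add2)
    moreover have "y \<le> h" if "y + (M - h) \<notin> A'"
      using M(2)[of "y + (M - h)"] that \<open>y + (M - h) \<in> T\<close> hM by auto
    moreover have "y \<in> A'" if "y \<in> A" "y \<le> h"
      using h_least[of y] that xy x by auto
    ultimately show "x = y + a \<and> y \<in> A'"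
      using x by blast
  qed
  then have "fock_act \<epsilon> ?u v + fock_scale (- ?b) (line_vec a h) \<in> pullback N"
    by (rule pullback_kernel)
  then have "fock_act \<epsilon> ?u v + fock_scale (- ?b) (line_vec a h) + fock_scale (- 1) (fock_act \<epsilon> ?u v) \<in> pullback N"
    by (rule pullback_add[OF _ pullback_scale[OF act]])
  moreover have "u + w + fock_scale (- 1) u = w" for u w :: fock_space
    by simp
  ultimately have "fock_scale (- ?b) (line_vec a h) \<in> pullback N"
    by (simp only:)
  then show ?thesis
    using b by (subst (asm) pullback_scale_iff) auto
qed

lemma pullback_full:
  assumes "line_vec a h \<in> pullback N"
  shows "pullback N = fock_line a A"
proof
  show "pullback N \<subseteq> fock_line a A"
    by (auto simp: pullback_def)
  have vec: "line_vec a m \<in> pullback N" if "m \<in> A" for m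
  proof (cases "m \<in> A'")
    case True
    then show ?thesis by (intro pullback_kernel) (simp add: line_vec_in)
  next
    case False
    then have m: "h \<le> m" "gbin \<epsilon> (m + a) (m - h) \<noteq> 0"
      using that h_least up by auto
    have "fock_act \<epsilon> (uq_f_dp (m - h)) (line_vec a h) \<in> pullback N"
      by (intro pullback_act Ures_int_dp assms)
    moreover have "h + a + (m - h) = m + a" "h + (m - h) = m"
      using m by auto
    ultimately show ?thesis
      using m by (simp add: fock_act_f_dp_single[OF eps] pullback_scale_iff)
  qed
  show "fock_line a A \<subseteq> pullback N"
  proof
    fix v assume "v \<in> fock_line a A"
    then obtain T where T: "finite T" "T \<subseteq> A"
      "v = (\<Sum>m\<in>T. fock_scale (Poly_Mapping.lookup v (m + a, m)) (line_vec a m))"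
      by (rule fock_line_expand)
    have "(\<Sum>m\<in>T. fock_scale (c m) (line_vec a m)) \<in> pullback N" for c
      using T(1,2)
    proof induction
      case empty
      show ?case using pullback_kernel[OF fock_line_zero] by simp
    qed (auto intro!: pullback_add pullback_scale vec)
    then show "v \<in> pullback N"
      by (subst T(3))
  qed
qed

lemma submodule_eq_carrier:
  assumes "pullback N = fock_line a A"
  shows "N = carrier V"
  using assms N unfolding pi_surj pullback_def V.submodule_iff by blast

end

lemma pi_h_nonzero: "\<pi> (line_vec a h) \<in> carrier V" "\<pi> (line_vec a h) \<noteq> \<zero>\<^bsub>V\<^esub>"
  using vec_h by (auto simp: pi_surj pi_ker)

lemma irreducible: "irreducible_module (Ures \<epsilon>) V"
  unfolding irreducible_module_def
proof (intro conjI allI impI V)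
  show "carrier V \<noteq> {\<zero>\<^bsub>V\<^esub>}"
    using pi_h_nonzero by auto
  fix N assume N: "submodule N (Ures \<epsilon>) V"
  show "N = {\<zero>\<^bsub>V\<^esub>} \<or> N = carrier V"
  proof (cases "N \<subseteq> {\<zero>\<^bsub>V\<^esub>}")
    case True
    then show ?thesis using N by (auto simp: V.submodule_iff)
  next
    case False
    then obtain x where "x \<in> N" "x \<noteq> \<zero>\<^bsub>V\<^esub>" by auto
    moreover from this obtain v where "v \<in> fock_line a A" "x = \<pi> v"
      using N unfolding V.submodule_iff pi_surj by blast
    ultimately have "v \<in> pullback N" "v \<notin> fock_line a A'"
      using pi_ker[of v] by (auto simp: pullback_def)
    then show ?thesis
      using submodule_eq_carrier[OF N pullback_full[OF N pullback_lowest[OF N]]] by blast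
  qed
qed

lemma generated: "generated_by (Ures \<epsilon>) V (\<pi> (line_vec a h))"
  unfolding generated_by_def
proof (intro conjI allI impI)
  fix N assume N: "submodule N (Ures \<epsilon>) V \<and> \<pi> (line_vec a h) \<in> N"
  then have "line_vec a h \<in> pullback N"
    using vec_h by (simp add: pullback_def)
  then show "N = carrier V"
    using N submodule_eq_carrier pullback_full by blast
qed (rule pi_h_nonzero)

lemma pi_zero: "\<pi> 0 = \<zero>\<^bsub>V\<^esub>"
  using pi_ker[of 0] by (simp add: fock_line_zero)

lemma pi_sum:
  assumes "finite T" "\<And>m. m \<in> T \<Longrightarrow> y m \<in> fock_line a A"
  shows "\<pi> (sum y T) = finsum V (\<lambda>m. \<pi> (y m)) T"
  using assms
proof (induction T)
  case (insert m T)
  then have "finsum V (\<lambda>m. \<pi> (y m)) (insert m T) = \<pi> (y m) \<oplus>\<^bsub>V\<^esub> finsum V (\<lambda>m. \<pi> (y m)) T"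
    by (intro V.finsum_insert) (auto simp: pi_surj)
  with insert show ?case
    by (simp add: pi_add fock_line_sum)
qed (simp add: pi_zero)

text \<open>The factor \<open>c\<close> is included because the summands in \<open>K_diagonalizable\<close> carry no coefficients.\<close>

lemma vec_K_eigenvector:
  assumes "m \<in> A - A'" "c \<noteq> 0"
  shows "K_eigenvector \<epsilon> V (\<pi> (fock_scale c (line_vec a m)))"
proof -
  let ?v = "fock_scale c (line_vec a m)" and ?d = "\<epsilon> powi (- int (Suc (m + a + m)))"
  have v: "?v \<in> fock_line a A" "?v \<notin> fock_line a A'"
    using assms by (auto simp: fock_line_iff lookup_fock_scale lookup_line_vec)
  have "fock_act \<epsilon> uq_K ?v = fock_scale ?d ?v"
    by (simp only: fock_act_scale[OF eps Ures_int.K] fock_act_K_single[OF eps] fock.scale_left_commute)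
  then have "spec \<epsilon> uq_K \<odot>\<^bsub>V\<^esub> \<pi> ?v = spec_scal \<epsilon> ?d \<odot>\<^bsub>V\<^esub> \<pi> ?v"
    using v by (metis Ures_int.K pi_act pi_scale)
  then show ?thesis
    using v by (auto simp: K_eigenvector_def pi_surj pi_ker)
qed

lemma diagonalizable: "K_diagonalizable \<epsilon> V"
  unfolding K_diagonalizable_def
proof
  fix x assume "x \<in> carrier V"
  then obtain v where v: "v \<in> fock_line a A" "x = \<pi> v"
    by (auto simp: pi_surj)
  let ?y = "\<lambda>m. fock_scale (Poly_Mapping.lookup v (m + a, m)) (line_vec a m)"
  obtain T where T: "finite T" "T \<subseteq> A" "\<And>m. m \<in> T \<longleftrightarrow> Poly_Mapping.lookup v (m + a, m) \<noteq> 0"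
    "v = sum ?y T"
    by (rule fock_line_expand[OF v(1)]) (rule that)
  have yA: "?y m \<in> fock_line a A" if "m \<in> T" for m
    using that T(2) by (intro fock_line_scale) (auto simp: line_vec_in)
  have yA': "\<pi> (?y m) = \<zero>\<^bsub>V\<^esub>" if "m \<in> T \<inter> A'" for m
    using that yA[of m] by (subst pi_ker) (auto intro!: fock_line_scale simp: line_vec_in)
  have "x = \<pi> (sum ?y T)"
    unfolding v(2) by (rule arg_cong[OF T(4)])
  also have "\<dots> = finsum V (\<lambda>m. \<pi> (?y m)) T"
    by (rule pi_sum[OF T(1) yA])
  also have "\<dots> = finsum V (\<lambda>m. \<pi> (?y m)) (T - A')"
    using yA yA' T(1) by (intro V.add.finprod_mono_neutral_cong_right) (auto simp: pi_surj)
  also have "\<dots> = finsum V (\<lambda>x. x) ((\<lambda>m. \<pi> (?y m)) ` (T - A'))"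
  proof -
    \<comment> \<open>The sum in \<open>K_diagonalizable\<close> is over a set of vectors, so the summands have to be distinct.\<close>
    have "inj_on (\<lambda>m. \<pi> (?y m)) (T - A')"
    proof (rule inj_onI, rule ccontr)
      fix m n assume mn: "m \<in> T - A'" "n \<in> T - A'" "\<pi> (?y m) = \<pi> (?y n)" "m \<noteq> n"
      define z where "z = fock_scale (- 1) (?y n)"
      have y: "?y m \<in> fock_line a A" "?y n \<in> fock_line a A"
        using mn yA by blast+
      have z: "z \<in> fock_line a A"
        unfolding z_def by (rule fock_line_scale[OF y(2)])
      have "\<pi> (?y m + z) = \<pi> (?y n + z)"
        by (simp only: pi_add[OF y(1) z] pi_add[OF y(2) z] mn(3))
      also have "?y n + z = 0"
        by (simp add: z_def)
      finally have "\<pi> (?y m + z) = \<zero>\<^bsub>V\<^esub>"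
        by (simp only: pi_zero)
      then have "?y m + z \<in> fock_line a A'"
        by (simp only: pi_ker[OF fock_line_add[OF y(1) z]])
      moreover have "Poly_Mapping.lookup (?y m + z) (m + a, m) \<noteq> 0"
        using mn T(3)[of m] unfolding z_def lookup_add lookup_fock_scale lookup_line_vec by simp
      ultimately have "m \<in> A'"
        unfolding fock_line_iff by blast
      then show False
        using mn(1) by blast
    qed
    then show ?thesis
      using yA by (subst V.finsum_reindex) (auto simp: pi_surj)
  qed
  finally show "\<exists>S. finite S \<and> (\<forall>x\<in>S. K_eigenvector \<epsilon> V x) \<and> x = finsum V (\<lambda>x. x) S"
    using T(1,2,3) vec_K_eigenvector by (intro exI[of _ "(\<lambda>m. \<pi> (?y m)) ` (T - A')"]) auto
qed

lemma root_powi_power: "(\<epsilon> powi k) ^ p = 1"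
proof -
  have "(\<epsilon> powi k) ^ p = (\<epsilon> ^ p) powi k"
    by (metis mult.commute power_int_mult power_int_of_nat)
  then show ?thesis by (simp add: root)
qed

lemma type_1: "type_1 \<epsilon> p V"
  unfolding type_1_def
proof (intro conjI V diagonalizable ballI)
  fix x assume "x \<in> carrier V"
  then obtain v where v: "v \<in> fock_line a A" "x = \<pi> v"
    by (auto simp: pi_surj)
  have "fock_act \<epsilon> (uq_K ^ p) v = v" "fock_act \<epsilon> (uq_Kinv ^ p) v = v"
    by (rule poly_mapping_eqI; simp add: split_paired_all lookup_fock_act_K_power[OF eps]
      lookup_fock_act_Kinv_power[OF eps] root_powi_power del: power_int_of_nat power_int_minus of_nat_Suc)+
  then show "spec \<epsilon> (uq_K ^ p) \<odot>\<^bsub>V\<^esub> x = x" "spec \<epsilon> (uq_Kinv ^ p) \<odot>\<^bsub>V\<^esub> x = x"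
    unfolding v(2) using pi_act[OF Ures_int_power v(1), of uq_K p] pi_act[OF Ures_int_power v(1), of uq_Kinv p]
    by (simp_all add: Ures_int.K Ures_int.Kinv)
qed

text \<open>The image of \<open>w\<^sub>h\<close> has an index below \<open>h\<close>, which lies in \<open>A'\<close> if it lies in \<open>A\<close>.\<close>

lemma e_dp_kills: "r > 0 \<Longrightarrow> spec \<epsilon> (uq_e_dp r) \<odot>\<^bsub>V\<^esub> \<pi> (line_vec a h) = \<zero>\<^bsub>V\<^esub>"
proof -
  assume r: "r > 0"
  let ?v = "fock_act \<epsilon> (uq_e_dp r) (line_vec a h)"
  have v: "?v \<in> fock_line a A"
    by (intro act_line Ures_int_dp vec_h)
  have "?v \<in> fock_line a A'"
    unfolding fock_line_iff
  proof (intro allI impI)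
    fix x y assume nz: "Poly_Mapping.lookup ?v (x, y) \<noteq> 0"
    then have x: "x = y + a" and y: "y \<in> A"
      using v unfolding fock_line_iff by blast+
    have "y + r = h"
      using nz unfolding lookup_fock_act_e_dp[OF eps] lookup_line_vec by (simp split: if_splits)
    then have "\<not> h \<le> y"
      using r by linarith
    with y h_least[of y] x show "x = y + a \<and> y \<in> A'"
      by blast
  qed
  then show ?thesis
    using v by (simp add: pi_act[symmetric] vec_h Ures_int_dp pi_ker)
qed

theorem is_Vres: "is_Vres \<epsilon> p V (- (2 * int h + int a + 1))"
proof -
  let ?w = "line_vec a h"
  have lam: "- (2 * int h + int a + 1) = - int (Suc (h + a + h))"
    by simp
  have "\<pi> ?w \<in> weight_space \<epsilon> p V (- (2 * int h + int a + 1))"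
    unfolding weight_space_def lam using pi_h_nonzero vec_h
    by (simp add: pi_act[symmetric] pi_scale[symmetric] Ures_int.K Ures_int_uq_Kbin
      fock_act_K_single[OF eps] fock_act_Kbin_single[OF eps] del: of_nat_Suc)
  moreover have "spec \<epsilon> uq_e \<odot>\<^bsub>V\<^esub> \<pi> ?w = \<zero>\<^bsub>V\<^esub>" "spec \<epsilon> (uq_e_dp p) \<odot>\<^bsub>V\<^esub> \<pi> ?w = \<zero>\<^bsub>V\<^esub>"
    using e_dp_kills[of 1] e_dp_kills[OF p] by (simp_all add: uq_e_eq_dp)
  ultimately show ?thesis
    unfolding is_Vres_def highest_weight_module_def
    using irreducible type_1 generated pi_h_nonzero by blast
qed

end

section \<open>The two subquotients of \<open>W\<^sup>s\<close>\<close>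

lemma submodule_fock_line:
  assumes "\<epsilon> \<noteq> 0" and "line_stable \<epsilon> a A"
  shows "submodule (fock_line a A) (Ures \<epsilon>) (fock_module \<epsilon>)"
proof -
  interpret left_module "Ures \<epsilon>" "fock_module \<epsilon>"
    by (rule left_module_fock[OF assms(1)])
  show ?thesis
    unfolding submodule_iff
    by (auto simp: fock_line_zero fock_line_add carrier_Ures fock_module_smult[OF assms(1)] fock_line_act[OF assms])
qed

lemma restrict_module_simps [simp]:
  "carrier (restrict_module M N) = N" "\<zero>\<^bsub>restrict_module M N\<^esub> = \<zero>\<^bsub>M\<^esub>"
  "x \<oplus>\<^bsub>restrict_module M N\<^esub> y = x \<oplus>\<^bsub>M\<^esub> y" "c \<odot>\<^bsub>restrict_module M N\<^esub> x = c \<odot>\<^bsub>M\<^esub> x"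
  by (simp_all add: restrict_module_def)

lemma line_stable_UNIV: "line_stable \<epsilon> a UNIV"
  by (simp add: line_stable_def)

definition low_residues :: "nat \<Rightarrow> nat \<Rightarrow> nat set" where
  "low_residues p a = {m. m mod p < p - a mod p}"

context
  fixes p a :: nat and \<epsilon> :: complex
  assumes p: "p > 1" "odd p"
    and root: "\<epsilon> ^ p = 1" and primitive: "\<forall>k. 0 < k \<and> k < p \<longrightarrow> \<epsilon> ^ k \<noteq> 1"
    and a: "a mod p \<noteq> 0"
begin

lemma eps_nonzero: "\<epsilon> \<noteq> 0"
  by (rule root_nonzero[OF p root primitive])

lemma mod_add_cases:
  "x mod p + y mod p < p \<and> (x + y) mod p = x mod p + y mod p
    \<or> p \<le> x mod p + y mod p \<and> (x + y) mod p + p = x mod p + y mod p"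
proof -
  have lt: "x mod p < p" "y mod p < p" using p by auto
  have eq: "(x + y) mod p = (x mod p + y mod p) mod p" by (simp add: mod_simps)
  show ?thesis
  proof (cases "x mod p + y mod p < p")
    case True
    then show ?thesis unfolding eq by simp
  next
    case False
    then have "(x mod p + y mod p) mod p = x mod p + y mod p - p"
      using lt by (simp only: le_mod_geq not_less) (rule mod_less, linarith)
    then show ?thesis unfolding eq using False by linarith
  qed
qed

lemma mod_p_less: "x mod p < p"
  using p by simp

text \<open>For \<open>m\<^sub>0 < p - a\<^sub>0\<close> no carry occurs in \<open>m + a\<close>. A step down that leaves these residues raises
  the lowest digit, so \<open>r\<^sub>0 > m\<^sub>0\<close>. A step up that leaves them carries when \<open>r\<close> is added to \<open>m + a\<close>,
  so \<open>r\<^sub>0\<close> exceeds the lowest digit of \<open>m + r + a\<close>.\<close>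

lemma line_stable_low_residues: "line_stable \<epsilon> a (low_residues p a)"
  unfolding line_stable_def
proof (intro ballI allI conjI impI)
  fix m r assume m: "m \<in> low_residues p a"
  show "gbin \<epsilon> m r = 0" if "r \<le> m \<and> m - r \<notin> low_residues p a"
  proof (rule gbin_root_eq_0[OF p root primitive])
    have "m - r + r = m" using that by simp
    then have "(m - r) mod p + r mod p < p \<and> m mod p = (m - r) mod p + r mod p
        \<or> p \<le> (m - r) mod p + r mod p \<and> m mod p + p = (m - r) mod p + r mod p"
      by (metis mod_add_cases)
    moreover have "m mod p < p - a mod p" "\<not> (m - r) mod p < p - a mod p"
      using m that by (simp_all add: low_residues_def)
    ultimately show "m mod p < r mod p"
      using mod_p_less[of "m - r"] by (elim disjE conjE) linarith+
  qed
  show "gbin \<epsilon> (m + r + a) r = 0" if "m + r \<notin> low_residues p a"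
  proof (rule gbin_root_eq_0[OF p root primitive])
    have low: "m mod p < p - a mod p" "\<not> (m + r) mod p < p - a mod p"
      using m that by (simp_all add: low_residues_def)
    have "(m + r + a) mod p + p = (m + r) mod p + a mod p"
      using mod_add_cases[of "m + r" a] low(2) by (elim disjE conjE) linarith+
    then show "(m + r + a) mod p < r mod p"
      using mod_add_cases[of m r] low mod_p_less[of a] mod_p_less[of m] mod_p_less[of r]
      by (elim disjE conjE) linarith+
  qed
qed

text \<open>With \<open>h = 0\<close> the step down is \<open>[m over m] = 1\<close>, and the step up \<open>[m + a over m]\<close> is free of carries by
  the choice of the residues.\<close>

lemma first_subquotient:
  "line_subquotient \<epsilon> p a 0 (low_residues p a) {} (restrict_module (fock_module \<epsilon>) (fock_line a (low_residues p a))) (\<lambda>v. v)"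
proof (rule line_subquotient.intro)
  show "left_module (Ures \<epsilon>) (restrict_module (fock_module \<epsilon>) (fock_line a (low_residues p a)))"
    by (intro left_module_restrict left_module_fock submodule_fock_line eps_nonzero line_stable_low_residues)
  show "v = \<zero>\<^bsub>restrict_module (fock_module \<epsilon>) (fock_line a (low_residues p a))\<^esub> \<longleftrightarrow> v \<in> fock_line a {}" for v
    by (auto simp: fock_line_def)
  show "0 \<in> (low_residues p a) - {}"
    using mod_p_less[of a] by (simp add: low_residues_def)
  show "gbin \<epsilon> (m + a) (m - 0) \<noteq> 0" if "m \<in> (low_residues p a) - {}" for m
  proof (rule gbin_root_neq_0[OF p root primitive])
    show "(m - 0) mod p \<le> (m + a) mod p"
      using that mod_add_cases[of m a] unfolding low_residues_def by auto
  qed simp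
qed (use p root in \<open>auto simp: line_stable_def line_stable_low_residues[unfolded line_stable_def] fock_module_smult[OF eps_nonzero]\<close>)

text \<open>For \<open>h = p - a\<^sub>0\<close> and \<open>m\<^sub>0 \<ge> h\<close>, the digit of \<open>m - h\<close> is \<open>m\<^sub>0 - h\<close>. This is at most \<open>m\<^sub>0\<close>, and it
  equals the digit of \<open>m + a\<close>, because \<open>h + a\<close> is a multiple of \<open>p\<close>. Hence neither coefficient vanishes.\<close>

lemma second_subquotient:
  defines "W \<equiv> restrict_module (fock_module \<epsilon>) (fock_line a UNIV)"
  shows "line_subquotient \<epsilon> p a (p - a mod p) UNIV (low_residues p a)
    (quotient_module W (fock_line a (low_residues p a))) (\<lambda>v. fock_line a (low_residues p a) +>\<^bsub>W\<^esub> v)"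
proof -
  have W: "left_module (Ures \<epsilon>) W"
    unfolding W_def
    by (intro left_module_restrict left_module_fock submodule_fock_line eps_nonzero line_stable_UNIV)
  interpret W: left_module "Ures \<epsilon>" W by (rule W)
  have N: "submodule (fock_line a (low_residues p a)) (Ures \<epsilon>) W"
    unfolding W.submodule_iff
    by (auto simp: W_def fock_line_zero fock_line_add carrier_Ures fock_module_smult[OF eps_nonzero]
        fock_line_act[OF eps_nonzero line_stable_low_residues] fock_line_mono[of "low_residues p a" UNIV, THEN subsetD])
  note quot = quotient_module_simps[OF W N]
  have [simp]: "carrier W = fock_line a UNIV" "x \<oplus>\<^bsub>W\<^esub> y = x + y" for x y
    by (simp_all add: W_def)
  have smult: "spec \<epsilon> u \<odot>\<^bsub>W\<^esub> v = fock_act \<epsilon> u v" if "u \<in> Ures_int" for u v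
    using that by (simp add: W_def fock_module_smult[OF eps_nonzero])
  have high: "p - a mod p \<le> m mod p" "p - a mod p \<le> m" if "m \<in> UNIV - (low_residues p a)" for m
    using that mod_less_eq_dividend[of m p] by (auto simp: low_residues_def simp del: mod_less_eq_dividend)
  have b: "p - a mod p < p"
    using a p by simp
  have mod_diff: "(m - (p - a mod p)) mod p = m mod p - (p - a mod p)" if "m \<in> UNIV - (low_residues p a)" for m
  proof -
    have "m = (m - (p - a mod p)) + (p - a mod p)"
      using high[OF that] by simp
    moreover have "(p - a mod p) mod p = p - a mod p"
      using b by simp
    ultimately have "(m - (p - a mod p)) mod p + (p - a mod p) < p \<and> m mod p = (m - (p - a mod p)) mod p + (p - a mod p)
      \<or> p \<le> (m - (p - a mod p)) mod p + (p - a mod p) \<and> m mod p + p = (m - (p - a mod p)) mod p + (p - a mod p)"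
      using mod_add_cases[of "m - (p - a mod p)" "p - a mod p"] by metis
    then show ?thesis
      using high[OF that] mod_p_less[of "m - (p - a mod p)"] by (elim disjE conjE) linarith+
  qed
  show ?thesis
  proof (rule line_subquotient.intro)
    show "left_module (Ures \<epsilon>) (quotient_module W (fock_line a (low_residues p a)))"
      by (rule left_module_quotient[OF W N])
    show "p - a mod p \<in> UNIV - (low_residues p a)"
      using b by (simp add: low_residues_def)
    fix m assume m: "m \<in> UNIV - (low_residues p a)"
    show "p - a mod p \<le> m"
      using high[OF m] by simp
    show "gbin \<epsilon> m (m - (p - a mod p)) \<noteq> 0"
      by (rule gbin_root_neq_0[OF p root primitive]) (simp_all add: mod_diff[OF m])
    show "gbin \<epsilon> (m + a) (m - (p - a mod p)) \<noteq> 0"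
    proof (rule gbin_root_neq_0[OF p root primitive])
      show "(m - (p - a mod p)) mod p \<le> (m + a) mod p"
        unfolding mod_diff[OF m] using high[OF m] mod_p_less[of a] mod_p_less[of m] mod_add_cases[of m a]
        by (elim disjE conjE) linarith+
    qed simp
  qed (use p root in \<open>simp_all add: line_stable_UNIV line_stable_low_residues quot smult[symmetric] spec_closed
      fock_line_act[OF eps_nonzero line_stable_UNIV]\<close>)
qed

end

lemma fock_w_nat: "fock_w s (int m) = line_vec (nat \<bar>s\<bar>) m"
proof -
  have "int m + \<bar>s\<bar> = int (m + nat \<bar>s\<bar>)"
    by simp
  then show ?thesis
    by (simp only: fock_w_def fock_g_nat)
qed

lemma fock_span_w:
  "fock_span {fock_w s m | m. m \<ge> 0 \<and> P m} = fock_line (nat \<bar>s\<bar>) {m. P (int m)}"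
proof -
  have "{fock_w s m | m. m \<ge> 0 \<and> P m} = line_vec (nat \<bar>s\<bar>) ` {m. P (int m)}"
    unfolding fock_w_nat[symmetric] by (auto elim!: nonneg_int_cases)
  then show ?thesis
    by (simp only: fock_span_line)
qed

lemma Ws_eq: "Ws s = fock_line (nat \<bar>s\<bar>) UNIV"
  unfolding Ws_def using fock_span_w[of s "\<lambda>_. True"] by simp

lemma Wprime_eq:
  assumes "p > 0"
  shows "Wprime p s = fock_line (nat \<bar>s\<bar>) {m. m mod p < p - nat \<bar>s\<bar> mod p}"
proof -
  have "int m mod int p < int p - \<bar>s\<bar> mod int p \<longleftrightarrow> m mod p < p - nat \<bar>s\<bar> mod p" for m
  proof -
    have "\<bar>s\<bar> mod int p = int (nat \<bar>s\<bar> mod p)" "int m mod int p = int (m mod p)" "nat \<bar>s\<bar> mod p < p"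
      using assms by (simp_all add: zmod_int)
    then show ?thesis by linarith
  qed
  then show ?thesis
    unfolding Wprime_def fock_span_w by (simp only:)
qed

theorem proposition5p4:
  fixes p :: nat and \<epsilon> :: complex and s :: int
  assumes "p > 1" and "odd p"
    and "\<epsilon> ^ p = 1" and "\<forall>k. 0 < k \<and> k < p \<longrightarrow> \<epsilon> ^ k \<noteq> 1"
    and "s < 0" and "s mod int p \<noteq> 0"
  shows "(\<exists>V :: (uq set, fock_space) module.
            is_Vres \<epsilon> p V (- (\<bar>s\<bar> + 1)) \<and>
            module_iso (Ures \<epsilon>) (restrict_module (fock_module \<epsilon>) (Wprime p s)) V) \<and>
         (\<exists>V :: (uq set, fock_space set) module.
            is_Vres \<epsilon> p V
              (- (int p - \<bar>s\<bar> mod int p + (1 + \<bar>s\<bar> div int p) * int p + 1)) \<and>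
            module_iso (Ures \<epsilon>)
              (quotient_module (restrict_module (fock_module \<epsilon>) (Ws s)) (Wprime p s)) V)"
proof -
  define a where "a = nat \<bar>s\<bar>"
  have s: "\<bar>s\<bar> = int a" by (simp add: a_def)
  have "\<not> int p dvd \<bar>s\<bar>"
    using assms(6) by (simp only: dvd_abs_iff mod_eq_0_iff_dvd not_False_eq_True)
  then have a: "a mod p \<noteq> 0"
    unfolding s by (simp only: int_dvd_int_iff mod_eq_0_iff_dvd not_False_eq_True)
  have lt: "a mod p < p"
    using assms(1) by simp
  have W': "Wprime p s = fock_line a (low_residues p a)"
    using assms(1) by (simp add: Wprime_eq low_residues_def a_def)
  have Ws: "Ws s = fock_line a UNIV"
    by (simp add: Ws_eq a_def)
  note first = first_subquotient[OF assms(1-4) a]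
  note second = second_subquotient[OF assms(1-4) a]
  have weight: "- (2 * int (p - a mod p) + int a + 1)
      = - (int p - int a mod int p + (1 + int a div int p) * int p + 1)"
  proof -
    have "int (p - a mod p) = int p - int a mod int p"
      using lt by (simp add: of_nat_diff zmod_int)
    moreover have "int a = int a div int p * int p + int a mod int p"
      by simp
    moreover have "(1 + int a div int p) * int p = int p + int a div int p * int p"
      by (simp add: algebra_simps)
    ultimately show ?thesis
      by linarith
  qed
  show ?thesis
    unfolding W' Ws s
  proof (intro conjI exI)
    show "is_Vres \<epsilon> p (restrict_module (fock_module \<epsilon>) (fock_line a (low_residues p a))) (- (int a + 1))"
      using line_subquotient.is_Vres[OF first] by simp
    show "is_Vres \<epsilon> p
        (quotient_module (restrict_module (fock_module \<epsilon>) (fock_line a UNIV)) (fock_line a (low_residues p a)))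
        (- (int p - int a mod int p + (1 + int a div int p) * int p + 1))"
      using line_subquotient.is_Vres[OF second] unfolding weight .
  qed (intro module_iso_refl line_subquotient.V[OF first] line_subquotient.V[OF second])+
qed

end
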